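(* For every $\tau\in(0,1)$ there is a constant $0<c_\tau<1$ depending only on $\tau$ such that the following holds. Let $M^*\in\mathbb R^{d\times d}$ be symmetric positive semidefinite of rank $r$, with factorization $M^*=F^*(F^* )^\top$, $F^*\in\mathbb R^{d\times r}$, and let $\sigma_1(F^* )\ge\dots\ge\sigma_r(F^* )>0$ and $\kappa=\sigma_1(F^* )/\sigma_r(F^* )$. Let $\tilde{\mathcal L}_n:\mathbb R^{d\times r}\to\mathbb R$, $\tilde{\mathcal L}_n(F)=\mathcal L_n(FF^\top)$, and let $\mathcal F\subseteq\mathbb R^{d\times r}$ be a convex set. Let $0<\alpha\le\beta=L$ and $0\le\varepsilon_n\le\frac{1-\tau}{4}\sigma_r(F^* )$, and put $\rho=(1-\tau^2)\sigma_r(F^* )$. Suppose that $\mathcal F$ is $M^*$-faithful with radius $\rho$ and that $\tilde{\mathcal L}_n$ satisfies over $\mathcal F$ the local descent condition with parameters $(\alpha,\beta,\varepsilon_n,\rho)$, the local Lipschitz condition with parameters $(L,\rho)$, and the local smoothness condition with parameters $(\alpha,\beta,\varepsilon_n,\rho)$. Then for any initial matrix $F^0\in\mathcal F\cap\mathbb B_2((1-\tau)\sigma_r(F^* );F^* )$, the projected gradient iterates $$F^{t+1}=\Pi_{\mathcal F}\big(F^t-\eta^t\nabla\tilde{\mathcal L}_n(F^t)\big),\qquad \eta^t=c_\tau\frac{\alpha}{\kappa^6\beta^2},\qquad t=0,1,2,\dots$$ satisfy $$d^2(F^t,F^* )\le\Big(1-c_\tau\frac{\alpha^2}{\kappa^6\beta^2}\Big)^t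 d^2(F^0,F^* )+16\,\varepsilon_n^2\qquad\text{for all } t=1,2,\dots.$$
   Context: Notation: $\|\cdot\|_F$ is the Frobenius norm, $\|\cdot\|_{op}$ the spectral norm, $\langle\langle A,B\rangle\rangle=\operatorname{trace}(A^\top B)$, and $\Pi_{\mathcal F}$ is the Euclidean (Frobenius) projection onto $\mathcal F$ (assumed well defined). $\mathcal L_n$ is a differentiable real-valued function on symmetric $d\times d$ matrices and $\nabla\tilde{\mathcal L}_n$ is the gradient of $\tilde{\mathcal L}_n$ with respect to $F$. Set of equivalent factorizations: $\mathcal E(M^* )=\{A\in\mathbb R^{d\times r}: AA^\top=M^*,\ A_{\cdot i}^\top A_{\cdot j}=0\ \forall i\ne j\}$, and $F^*$ denotes an element of it; all elements have the same singular values, so $\sigma_j(F^* )$ and $\|F^*\|_{op}$ are unambiguous. Distance: $d(F,F^* )=\min_{A\in\mathcal E(M^* )}\|F-A\|_F$. Ball: $\mathbb B_2(\rho;F^* )=\{F\in\mathbb R^{d\times r}: d(F,F^* )\le\rho\}$. $M^*$-faithfulness (radius $\rho$): for each $F\in\mathcal F\cap\mathbb B_2(\rho;F^* )$, $\arg\min_{A\in\mathcal E(M^* )}\|A-F\|_F\subseteq\mathcal F$. Local descent condition with parameters $(\alpha,\beta,\varepsilon_n,\rho)$ over $\mathcal F$: for each $F\in\mathcal F\cap\mathbb B_2(\rho;F^* )$ there is some $F_{\pi^*}\in\arg\min_{A\in\mathcal E(M^* )}\|A-F\|_F$ such that for all $A\in\mathcal E(M^* )$, $$\langle\langle\nabla\tilde{\mathcal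 L}_n(F),F-A\rangle\rangle\ge\alpha\|F-F_{\pi^*}\|_F^2-\frac{\beta^2}{\alpha}\|F_{\pi^*}-A\|_F^2-\alpha\varepsilon_n^2 .$$ Local Lipschitz condition with parameters $(L,\rho)$: $\|\nabla\tilde{\mathcal L}_n(F)\|_F\le L\|F^*\|_{op}$ for all $F\in\mathcal F\cap\mathbb B_2(\rho;F^* )$. Local smoothness condition with parameters $(\alpha,\beta,\varepsilon_n,\rho)$ over $\mathcal F$: for all $F,F'\in\mathcal F\cap\mathbb B_2(\rho;F^* )$ and all $A\in\mathcal E(M^* )$, $$\big|\langle\langle\nabla\tilde{\mathcal L}_n(F)-\nabla\tilde{\mathcal L}_n(F'),F-A\rangle\rangle\big|\le\big(\beta\|F-F'\|_F+\alpha\varepsilon_n\big)\|F-A\|_F .$$ *)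

theory Defs
  imports
    Jordan_Normal_Form.Char_Poly
    Jordan_Normal_Form.DL_Rank
    "HOL-Library.Multiset"
begin

text \<open>
  Matrices are those of the theory \<^theory>\<open>Jordan_Normal_Form.Matrix\<close>, whose dimensions are natural
  numbers. The constant of the theorem must not depend on the dimensions, so these have to be
  quantified inside the scope of an existential quantifier, which rules out type-indexed matrices.
\<close>

definition frob_inner :: "real mat \<Rightarrow> real mat \<Rightarrow> real" where
  "frob_inner A B = sum_list (diag_mat (transpose_mat A * B))"

definition frob_norm :: "real mat \<Rightarrow> real" where
  "frob_norm A = sqrt (frob_inner A A)"

definition spectral_norm :: "real mat \<Rightarrow> real" where
  "spectral_norm A =
     (SUP v\<in>{v \<in> carrier_vec (dim_col A). v \<bullet> v \<le> 1}. sqrt ((A *\<^sub>v v) \<bullet> (A *\<^sub>v v)))"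

text \<open>
  The singular values are the square roots of the \<open>dim_col A\<close> eigenvalues of \<open>A\<^sup>T A\<close>, counted with
  multiplicity and listed in descending order; \<open>sing_val j\<close> is the \<open>j\<close>-th one, for \<open>j \<ge> 1\<close>.
\<close>

definition singular_values :: "real mat \<Rightarrow> real list" where
  "singular_values A =
     rev (sorted_list_of_multiset (image_mset sqrt (proots (char_poly (transpose_mat A * A)))))"

definition sing_val :: "nat \<Rightarrow> real mat \<Rightarrow> real" where
  "sing_val j A = singular_values A ! (j - 1)"

definition sym_mats :: "nat \<Rightarrow> real mat set" where
  "sym_mats d = {A \<in> carrier_mat d d. transpose_mat A = A}"

definition psd_mat :: "nat \<Rightarrow> real mat \<Rightarrow> bool" where
  "psd_mat d A \<longleftrightarrow> A \<in> sym_mats d \<and> (\<forall>v\<in>carrier_vec d. 0 \<le> v \<bullet> (A *\<^sub>v v))"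

definition convex_mats :: "real mat set \<Rightarrow> bool" where
  "convex_mats S \<longleftrightarrow>
     (\<forall>A\<in>S. \<forall>B\<in>S. \<forall>u. 0 \<le> u \<and> u \<le> 1 \<longrightarrow> (1 - u) \<cdot>\<^sub>m A + u \<cdot>\<^sub>m B \<in> S)"

text \<open>
  Frechet differentiability of \<open>f\<close> at \<open>X\<close>, relative to a linear space \<open>V\<close> of matrices (all
  \<open>d \<times> r\<close> matrices, or the symmetric ones), with the derivative represented by \<open>G\<close> through the
  Frobenius inner product.
\<close>

definition has_gradient_on :: "real mat set \<Rightarrow> (real mat \<Rightarrow> real) \<Rightarrow> real mat \<Rightarrow> real mat \<Rightarrow> bool" where
  "has_gradient_on V f G X \<longleftrightarrow> X \<in> V \<and> G \<in> V \<and>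
     (\<forall>e>0. \<exists>\<delta>>0. \<forall>H\<in>V. frob_norm H < \<delta> \<longrightarrow>
        \<bar>f (X + H) - f X - frob_inner G H\<bar> \<le> e * frob_norm H)"

definition gradient :: "nat \<Rightarrow> nat \<Rightarrow> (real mat \<Rightarrow> real) \<Rightarrow> real mat \<Rightarrow> real mat" where
  "gradient d r f X = (THE G. has_gradient_on (carrier_mat d r) f G X)"

definition nearest_points :: "real mat set \<Rightarrow> real mat \<Rightarrow> real mat set" where
  "nearest_points S X = {P \<in> S. \<forall>Q\<in>S. frob_norm (P - X) \<le> frob_norm (Q - X)}"

definition proj_well_defined :: "nat \<Rightarrow> nat \<Rightarrow> real mat set \<Rightarrow> bool" where
  "proj_well_defined d r S \<longleftrightarrow> (\<forall>X\<in>carrier_mat d r. \<exists>!P. P \<in> nearest_points S X)"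

definition proj_onto :: "real mat set \<Rightarrow> real mat \<Rightarrow> real mat" where
  "proj_onto S X = (THE P. P \<in> nearest_points S X)"

definition equiv_factors :: "nat \<Rightarrow> nat \<Rightarrow> real mat \<Rightarrow> real mat set" where
  "equiv_factors d r M = {A \<in> carrier_mat d r. A * transpose_mat A = M \<and>
     (\<forall>i<r. \<forall>j<r. i \<noteq> j \<longrightarrow> col A i \<bullet> col A j = 0)}"

text \<open>
  The distance \<open>d(F, F\<^sup>*)\<close> depends on \<open>F\<^sup>*\<close> only through \<open>M = F\<^sup>* F\<^sup>*\<^sup>T\<close>, which is therefore the
  parameter here. The infimum is a minimum, since the set of factors is compact.
\<close>

definition factor_dist :: "nat \<Rightarrow> nat \<Rightarrow> real mat \<Rightarrow> real mat \<Rightarrow> real" where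
  "factor_dist d r M F = (INF A\<in>equiv_factors d r M. frob_norm (F - A))"

definition factor_ball :: "nat \<Rightarrow> nat \<Rightarrow> real mat \<Rightarrow> real \<Rightarrow> real mat set" where
  "factor_ball d r M \<rho> = {F \<in> carrier_mat d r. factor_dist d r M F \<le> \<rho>}"

definition faithful :: "nat \<Rightarrow> nat \<Rightarrow> real mat \<Rightarrow> real mat set \<Rightarrow> real \<Rightarrow> bool" where
  "faithful d r M S \<rho> \<longleftrightarrow>
     (\<forall>F \<in> S \<inter> factor_ball d r M \<rho>. nearest_points (equiv_factors d r M) F \<subseteq> S)"

text \<open>In the three conditions below, \<open>f\<close> is the loss as a function of the factor.\<close>

definition local_descent ::
  "nat \<Rightarrow> nat \<Rightarrow> real mat \<Rightarrow> (real mat \<Rightarrow> real) \<Rightarrow> real mat set \<Rightarrow> real \<Rightarrow> real \<Rightarrow> real \<Rightarrow> real \<Rightarrow> bool"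
where
  "local_descent d r M f S \<alpha> \<beta> \<epsilon> \<rho> \<longleftrightarrow>
     (\<forall>F \<in> S \<inter> factor_ball d r M \<rho>. \<exists>P \<in> nearest_points (equiv_factors d r M) F.
        \<forall>A \<in> equiv_factors d r M.
          frob_inner (gradient d r f F) (F - A) \<ge>
            \<alpha> * (frob_norm (F - P))\<^sup>2 - \<beta>\<^sup>2 / \<alpha> * (frob_norm (P - A))\<^sup>2 - \<alpha> * \<epsilon>\<^sup>2)"

definition local_lipschitz ::
  "nat \<Rightarrow> nat \<Rightarrow> real mat \<Rightarrow> real mat \<Rightarrow> (real mat \<Rightarrow> real) \<Rightarrow> real mat set \<Rightarrow> real \<Rightarrow> real \<Rightarrow> bool"
where
  "local_lipschitz d r M Fstar f S L \<rho> \<longleftrightarrow>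
     (\<forall>F \<in> S \<inter> factor_ball d r M \<rho>. frob_norm (gradient d r f F) \<le> L * spectral_norm Fstar)"

definition local_smooth ::
  "nat \<Rightarrow> nat \<Rightarrow> real mat \<Rightarrow> (real mat \<Rightarrow> real) \<Rightarrow> real mat set \<Rightarrow> real \<Rightarrow> real \<Rightarrow> real \<Rightarrow> real \<Rightarrow> bool"
where
  "local_smooth d r M f S \<alpha> \<beta> \<epsilon> \<rho> \<longleftrightarrow>
     (\<forall>F \<in> S \<inter> factor_ball d r M \<rho>. \<forall>F' \<in> S \<inter> factor_ball d r M \<rho>. \<forall>A \<in> equiv_factors d r M.
        \<bar>frob_inner (gradient d r f F - gradient d r f F') (F - A)\<bar> \<le>
          (\<beta> * frob_norm (F - F') + \<alpha> * \<epsilon>) * frob_norm (F - A))"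

end

theory Submission
  imports Defs "HOL-Analysis.L2_Norm"
begin

text \<open>
  All factors of \<open>M\<close> have the same Frobenius norm, so a nearest factor \<open>P\<close> of \<open>F\<close> maximises the
  inner product with \<open>F\<close>. Any other factor is \<open>A = P V\<close> with \<open>V\<close> orthogonal. If the column norms of
  \<open>A\<close> and \<open>P\<close> differ, at least two columns of \<open>A\<close> are orthogonal to the corresponding columns of
  \<open>P\<close>, and \<open>A\<close> is at distance at least \<open>2 \<sigma>\<^sub>r\<close> from \<open>P\<close>; otherwise \<open>V\<close> commutes with \<open>P\<^sup>T P\<close>,
  and optimality makes the relevant entries of \<open>P\<^sup>T F\<close> symmetric. In both cases
  \<open>\<langle>F, P - A\<rangle> \<ge> \<tau>\<^sup>2 / 2 \<parallel>P - A\<parallel>\<^sup>2\<close>, so on the ball the nearest factor is a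
  \<open>1 / \<tau>\<^sup>2\<close>-Lipschitz function of \<open>F\<close>. The variational inequality of the projection, the descent
  condition at the new iterate (tested against the old nearest factor) and the smoothness condition
  then bound the new squared distance by the old one; the displacement of the nearest factor is
  absorbed by the squared step length.
\<close>

subsection \<open>The Frobenius inner product\<close>

lemma frob_inner_sum:
  assumes "A \<in> carrier_mat m n" "B \<in> carrier_mat m n"
  shows "frob_inner A B = (\<Sum>p\<in>{..<m}\<times>{..<n}. A $$ p * B $$ p)"
proof -
  have "frob_inner A B = (\<Sum>j<n. \<Sum>i<m. A $$ (i, j) * B $$ (i, j))"
    using assms unfolding frob_inner_def diag_mat_def
    by (auto simp: interv_sum_list_conv_sum_set_nat scalar_prod_def atLeast0LessThan intro!: sum.cong)
  also have "\<dots> = (\<Sum>p\<in>{..<m}\<times>{..<n}. A $$ p * B $$ p)"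
    by (subst sum.swap) (simp add: sum.cartesian_product)
  finally show ?thesis .
qed

lemma frob_inner_double_sum:
  assumes "A \<in> carrier_mat m n" "B \<in> carrier_mat m n"
  shows "frob_inner A B = (\<Sum>i<m. \<Sum>j<n. A $$ (i, j) * B $$ (i, j))"
  by (simp add: frob_inner_sum[OF assms] sum.cartesian_product)

lemma frob_inner_commute:
  assumes "A \<in> carrier_mat m n" "B \<in> carrier_mat m n"
  shows "frob_inner A B = frob_inner B A"
  by (simp add: frob_inner_sum[OF assms] frob_inner_sum[OF assms(2,1)] mult.commute)

lemma frob_inner_add_left:
  assumes "A \<in> carrier_mat m n" "B \<in> carrier_mat m n" "C \<in> carrier_mat m n"
  shows "frob_inner (A + B) C = frob_inner A C + frob_inner B C"
proof -
  have "A + B \<in> carrier_mat m n" using assms by simp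
  then show ?thesis
    using assms by (simp add: frob_inner_double_sum[of _ m n] sum.distrib distrib_right)
qed

lemma frob_inner_diff_left:
  assumes "A \<in> carrier_mat m n" "B \<in> carrier_mat m n" "C \<in> carrier_mat m n"
  shows "frob_inner (A - B) C = frob_inner A C - frob_inner B C"
proof -
  have "A - B \<in> carrier_mat m n" using assms by (intro minus_carrier_mat)
  then show ?thesis
    using assms by (simp add: frob_inner_double_sum[of _ m n] sum_subtractf left_diff_distrib)
qed

lemma frob_inner_smult_left:
  assumes "A \<in> carrier_mat m n" "B \<in> carrier_mat m n"
  shows "frob_inner (a \<cdot>\<^sub>m A) B = a * frob_inner A B"
proof -
  have "a \<cdot>\<^sub>m A \<in> carrier_mat m n" using assms by simp
  then show ?thesis
    using assms by (simp add: frob_inner_double_sum[of _ m n] sum_distrib_left algebra_simps)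
qed

lemma frob_inner_add_right:
  assumes "A \<in> carrier_mat m n" "B \<in> carrier_mat m n" "C \<in> carrier_mat m n"
  shows "frob_inner C (A + B) = frob_inner C A + frob_inner C B"
  using frob_inner_add_left[OF assms] assms by (simp add: frob_inner_commute[of C m n])

lemma frob_inner_diff_right:
  assumes "A \<in> carrier_mat m n" "B \<in> carrier_mat m n" "C \<in> carrier_mat m n"
  shows "frob_inner C (A - B) = frob_inner C A - frob_inner C B"
  using frob_inner_diff_left[OF assms] assms minus_carrier_mat[of B m n A]
  by (simp add: frob_inner_commute[of C m n])

lemma frob_inner_smult_right:
  assumes "A \<in> carrier_mat m n" "B \<in> carrier_mat m n"
  shows "frob_inner A (a \<cdot>\<^sub>m B) = a * frob_inner A B"
  using frob_inner_smult_left[OF assms(2,1)] assms by (simp add: frob_inner_commute[of A m n])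

lemma frob_inner_transpose:
  assumes "A \<in> carrier_mat m n" "B \<in> carrier_mat m n"
  shows "frob_inner (transpose_mat A) (transpose_mat B) = frob_inner A B"
proof -
  have "frob_inner (transpose_mat A) (transpose_mat B)
      = (\<Sum>j<n. \<Sum>i<m. A $$ (i, j) * B $$ (i, j))"
    using assms by (simp add: frob_inner_double_sum[of _ n m])
  also have "\<dots> = frob_inner A B"
    by (subst sum.swap) (simp add: frob_inner_double_sum[OF assms])
  finally show ?thesis .
qed

text \<open>Both sides are the same triple sum in a different order: left multiplication by
  \<open>B\<close> has left multiplication by \<open>transpose_mat B\<close> as its adjoint. With
  the transposed form that follows, this moves factors across the inner product in all later matrix
  computations.\<close>

lemma frob_inner_mult_right:
  assumes "A \<in> carrier_mat m n" "B \<in> carrier_mat m k" "C \<in> carrier_mat k n"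
  shows "frob_inner A (B * C) = frob_inner (transpose_mat B * A) C"
proof -
  have "frob_inner A (B * C) = (\<Sum>i<m. \<Sum>j<n. \<Sum>l<k. A $$ (i, j) * B $$ (i, l) * C $$ (l, j))"
    using assms by (simp add: frob_inner_double_sum[of _ m n] scalar_prod_def atLeast0LessThan
        sum_distrib_left mult.assoc)
  also have "\<dots> = (\<Sum>i<m. \<Sum>l<k. \<Sum>j<n. A $$ (i, j) * B $$ (i, l) * C $$ (l, j))"
    by (intro sum.cong refl sum.swap)
  also have "\<dots> = (\<Sum>l<k. \<Sum>i<m. \<Sum>j<n. A $$ (i, j) * B $$ (i, l) * C $$ (l, j))"
    by (rule sum.swap)
  also have "\<dots> = (\<Sum>l<k. \<Sum>j<n. \<Sum>i<m. A $$ (i, j) * B $$ (i, l) * C $$ (l, j))"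
    by (intro sum.cong refl sum.swap)
  also have "\<dots> = frob_inner (transpose_mat B * A) C"
    using assms by (simp add: frob_inner_double_sum[of _ k n] scalar_prod_def atLeast0LessThan
        sum_distrib_left sum_distrib_right mult_ac)
  finally show ?thesis .
qed

lemma frob_inner_mult_transpose:
  assumes "A \<in> carrier_mat m n" "B \<in> carrier_mat m k" "C \<in> carrier_mat n k"
  shows "frob_inner A (B * transpose_mat C) = frob_inner (A * C) B"
proof -
  have "frob_inner A (B * transpose_mat C) = frob_inner (transpose_mat A) (C * transpose_mat B)"
    using assms frob_inner_transpose[of A m n "B * transpose_mat C"]
    by (simp add: transpose_mult[of B m k "transpose_mat C" n])
  also have "\<dots> = frob_inner (transpose_mat C * transpose_mat A) (transpose_mat B)"
    using assms by (intro frob_inner_mult_right) auto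
  also have "\<dots> = frob_inner (A * C) B"
    using assms frob_inner_transpose[of "A * C" m k B] by (simp add: transpose_mult[of A m n C k])
  finally show ?thesis .
qed

section \<open>The Frobenius norm as the Euclidean norm of the entries\<close>

lemma frob_norm_L2_set:
  assumes "A \<in> carrier_mat m n"
  shows "frob_norm A = L2_set (\<lambda>p. A $$ p) ({..<m}\<times>{..<n})"
  by (simp add: frob_norm_def L2_set_def frob_inner_sum[OF assms assms] power2_eq_square)

lemma frob_norm_power2:
  assumes "A \<in> carrier_mat m n"
  shows "(frob_norm A)\<^sup>2 = frob_inner A A"
  by (simp add: frob_norm_def frob_inner_sum[OF assms assms] sum_nonneg)

lemma frob_norm_nonneg:
  assumes "A \<in> carrier_mat m n"
  shows "0 \<le> frob_norm A"
  by (simp add: frob_norm_L2_set[OF assms] L2_set_nonneg)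

lemma frob_norm_eq_0D:
  assumes "A \<in> carrier_mat m n" "frob_norm A = 0"
  shows "A = 0\<^sub>m m n"
  using assms by (intro eq_matI) (auto simp: frob_norm_L2_set[OF assms(1)] L2_set_eq_0_iff)

lemma frob_norm_diff_eq_0D:
  assumes A: "A \<in> carrier_mat m n" and B: "B \<in> carrier_mat m n" and "frob_norm (A - B) = 0"
  shows "A = B"
proof -
  have "A - B = 0\<^sub>m m n" using minus_carrier_mat[OF B] assms(3) by (rule frob_norm_eq_0D)
  then have "A $$ (i, j) - B $$ (i, j) = 0" if "i < m" "j < n" for i j
    using that A B by (metis carrier_matD index_minus_mat(1) index_zero_mat(1))
  then show ?thesis using A B by (intro eq_matI) auto
qed

lemma frob_norm_0 [simp]: "frob_norm (0\<^sub>m m n) = 0"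
  by (subst frob_norm_L2_set[of _ m n]) (auto simp: L2_set_eq_0_iff)

lemma frob_norm_smult:
  assumes "A \<in> carrier_mat m n"
  shows "frob_norm (a \<cdot>\<^sub>m A) = \<bar>a\<bar> * frob_norm A"
proof -
  have "a \<cdot>\<^sub>m A \<in> carrier_mat m n" using assms by simp
  then have "frob_inner (a \<cdot>\<^sub>m A) (a \<cdot>\<^sub>m A) = a\<^sup>2 * frob_inner A A"
    using assms by (simp add: frob_inner_smult_left[of A m n] frob_inner_smult_right[of _ m n A]
        power2_eq_square)
  then show ?thesis by (simp add: frob_norm_def real_sqrt_mult)
qed

lemma frob_norm_minus_commute:
  assumes "A \<in> carrier_mat m n" "B \<in> carrier_mat m n"
  shows "frob_norm (A - B) = frob_norm (B - A)"
proof -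
  have "B - A = (- 1) \<cdot>\<^sub>m (A - B)" using assms by (intro eq_matI) auto
  then show ?thesis
    using frob_norm_smult[of "A - B" m n "- 1"] minus_carrier_mat[OF assms(2), of A] by simp
qed

lemma frob_norm_transpose:
  assumes "A \<in> carrier_mat m n"
  shows "frob_norm (transpose_mat A) = frob_norm A"
  by (simp add: frob_norm_def frob_inner_transpose[OF assms assms])

lemma abs_frob_inner_le:
  assumes "A \<in> carrier_mat m n" "B \<in> carrier_mat m n"
  shows "\<bar>frob_inner A B\<bar> \<le> frob_norm A * frob_norm B"
proof -
  have "\<bar>frob_inner A B\<bar> \<le> (\<Sum>p\<in>{..<m}\<times>{..<n}. \<bar>A $$ p\<bar> * \<bar>B $$ p\<bar>)"
    by (simp add: frob_inner_sum[OF assms] flip: abs_mult)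
  also have "\<dots> \<le> frob_norm A * frob_norm B"
    unfolding frob_norm_L2_set[OF assms(1)] frob_norm_L2_set[OF assms(2)]
    by (rule L2_set_mult_ineq)
  finally show ?thesis .
qed

lemma frob_norm_add_le:
  assumes "A \<in> carrier_mat m n" "B \<in> carrier_mat m n"
  shows "frob_norm (A + B) \<le> frob_norm A + frob_norm B"
proof -
  have "frob_norm (A + B) = L2_set (\<lambda>p. A $$ p + B $$ p) ({..<m}\<times>{..<n})"
    using assms by (subst frob_norm_L2_set[of _ m n]) (auto intro!: L2_set_cong)
  then show ?thesis
    by (simp add: L2_set_triangle_ineq frob_norm_L2_set[OF assms(1)] frob_norm_L2_set[OF assms(2)])
qed

lemma frob_norm_triangle:
  assumes "A \<in> carrier_mat m n" "B \<in> carrier_mat m n" "C \<in> carrier_mat m n"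
  shows "frob_norm (A - C) \<le> frob_norm (A - B) + frob_norm (B - C)"
proof -
  have "A - C = (A - B) + (B - C)" using assms by (intro eq_matI) auto
  then show ?thesis using frob_norm_add_le[of "A - B" m n "B - C"] assms
    by (simp add: minus_carrier_mat)
qed

lemma frob_norm_diff_power2:
  assumes "A \<in> carrier_mat m n" "B \<in> carrier_mat m n"
  shows "(frob_norm (A - B))\<^sup>2 = (frob_norm A)\<^sup>2 - 2 * frob_inner A B + (frob_norm B)\<^sup>2"
proof -
  have "A - B \<in> carrier_mat m n" using assms by (intro minus_carrier_mat)
  then show ?thesis using assms
    by (simp add: frob_norm_power2[of _ m n] frob_inner_diff_left[of _ m n]
        frob_inner_diff_right[of _ m n] frob_inner_commute[of B m n A])
qed

text \<open>Cauchy-Schwarz bounds each squared entry of the product by a squared row norm of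
  \<open>A\<close> times a squared column norm of \<open>B\<close>; the sum over all entries then
  factorises.\<close>

lemma frob_norm_mult_le:
  assumes "A \<in> carrier_mat m k" "B \<in> carrier_mat k n"
  shows "frob_norm (A * B) \<le> frob_norm A * frob_norm B"
proof (rule power2_le_imp_le)
  have cs: "(\<Sum>l<k. x l * y l)\<^sup>2 \<le> (\<Sum>l<k. (x l)\<^sup>2) * (\<Sum>l<k. (y l)\<^sup>2)" for x y :: "nat \<Rightarrow> real"
  proof -
    have "\<bar>\<Sum>l<k. x l * y l\<bar> \<le> (\<Sum>l<k. \<bar>x l\<bar> * \<bar>y l\<bar>)"
      by (simp flip: abs_mult)
    also have "\<dots> \<le> L2_set x {..<k} * L2_set y {..<k}" by (rule L2_set_mult_ineq)
    finally have "(\<Sum>l<k. x l * y l)\<^sup>2 \<le> (L2_set x {..<k} * L2_set y {..<k})\<^sup>2"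
      by (metis abs_ge_zero power2_abs power_mono)
    then show ?thesis by (simp add: power_mult_distrib L2_set_def sum_nonneg)
  qed
  have "(frob_norm (A * B))\<^sup>2 = (\<Sum>i<m. \<Sum>j<n. (\<Sum>l<k. A $$ (i, l) * B $$ (l, j))\<^sup>2)"
    using assms frob_norm_power2[of "A * B" m n]
    by (simp add: frob_inner_double_sum[of _ m n] scalar_prod_def atLeast0LessThan power2_eq_square)
  also have "\<dots> \<le> (\<Sum>i<m. \<Sum>j<n. (\<Sum>l<k. (A $$ (i, l))\<^sup>2) * (\<Sum>l<k. (B $$ (l, j))\<^sup>2))"
    by (intro sum_mono cs)
  also have "\<dots> = (\<Sum>i<m. \<Sum>l<k. (A $$ (i, l))\<^sup>2) * (\<Sum>j<n. \<Sum>l<k. (B $$ (l, j))\<^sup>2)"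
    by (simp add: sum_product)
  also have "(\<Sum>j<n. \<Sum>l<k. (B $$ (l, j))\<^sup>2) = (\<Sum>l<k. \<Sum>j<n. (B $$ (l, j))\<^sup>2)"
    by (rule sum.swap)
  also have "(\<Sum>i<m. \<Sum>l<k. (A $$ (i, l))\<^sup>2) * (\<Sum>l<k. \<Sum>j<n. (B $$ (l, j))\<^sup>2)
      = (frob_norm A * frob_norm B)\<^sup>2"
    by (simp add: power_mult_distrib frob_norm_power2[OF assms(1)] frob_norm_power2[OF assms(2)]
        frob_inner_double_sum[OF assms(1,1)] frob_inner_double_sum[OF assms(2,2)]
        flip: power2_eq_square)
  finally show "(frob_norm (A * B))\<^sup>2 \<le> (frob_norm A * frob_norm B)\<^sup>2" .
  show "0 \<le> frob_norm A * frob_norm B"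
    by (intro mult_nonneg_nonneg frob_norm_nonneg[OF assms(1)] frob_norm_nonneg[OF assms(2)])
qed

lemma frob_norm_add_power2:
  assumes "A \<in> carrier_mat m n" "B \<in> carrier_mat m n"
  shows "(frob_norm (A + B))\<^sup>2 = (frob_norm A)\<^sup>2 + 2 * frob_inner A B + (frob_norm B)\<^sup>2"
proof -
  have "A + B \<in> carrier_mat m n" using assms by simp
  then show ?thesis using assms
    by (simp add: frob_norm_power2[of _ m n] frob_inner_add_left[of _ m n]
        frob_inner_add_right[of _ m n] frob_inner_commute[of B m n A])
qed

subsection \<open>Gradients\<close>

text \<open>Tested along a small multiple of \<open>G - G'\<close>, the two linear approximations
  differ by more than their error bounds together allow. Uniqueness is what gives meaning to the
  \<open>THE\<close> in \<open>gradient\<close>.\<close>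

lemma has_gradient_on_unique:
  assumes "has_gradient_on (carrier_mat m n) f G X" "has_gradient_on (carrier_mat m n) f G' X"
  shows "G = G'"
proof (rule ccontr)
  assume ne: "G \<noteq> G'"
  have G: "G \<in> carrier_mat m n" and G': "G' \<in> carrier_mat m n"
    using assms by (auto simp: has_gradient_on_def)
  define D where "D = G - G'"
  have D: "D \<in> carrier_mat m n" unfolding D_def using G' by (rule minus_carrier_mat)
  have "frob_norm D \<noteq> 0" using frob_norm_diff_eq_0D[OF G G'] ne by (auto simp: D_def)
  with frob_norm_nonneg[OF D] have pos: "frob_norm D > 0" by simp
  define N where "N = frob_norm D"
  have N: "N > 0" and N4: "N / 4 > 0" using pos by (simp_all add: N_def)
  obtain \<delta>1 where d1: "\<delta>1 > 0" "\<And>H. H \<in> carrier_mat m n \<Longrightarrow> frob_norm H < \<delta>1 \<Longrightarrow>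
      \<bar>f (X + H) - f X - frob_inner G H\<bar> \<le> N / 4 * frob_norm H"
    using assms(1) N4 unfolding has_gradient_on_def by blast
  obtain \<delta>2 where d2: "\<delta>2 > 0" "\<And>H. H \<in> carrier_mat m n \<Longrightarrow> frob_norm H < \<delta>2 \<Longrightarrow>
      \<bar>f (X + H) - f X - frob_inner G' H\<bar> \<le> N / 4 * frob_norm H"
    using assms(2) N4 unfolding has_gradient_on_def by blast
  \<comment> \<open>With this factor the test direction \<open>t \<cdot>\<^sub>m D\<close> has norm
    \<open>min \<delta>1 \<delta>2 / 2\<close>, which lies inside both neighbourhoods.\<close>
  define t where "t = min \<delta>1 \<delta>2 / (2 * N)"
  have t: "t > 0" using d1 d2 N by (simp add: t_def)
  have H: "t \<cdot>\<^sub>m D \<in> carrier_mat m n" using D by simp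
  have nH: "frob_norm (t \<cdot>\<^sub>m D) = t * N" using t by (simp add: frob_norm_smult[OF D] N_def)
  have "t * N = min \<delta>1 \<delta>2 / 2" using N by (simp add: t_def)
  then have "t * N < \<delta>1" "t * N < \<delta>2" using d1(1) d2(1) by auto
  then have "\<bar>frob_inner G (t \<cdot>\<^sub>m D) - frob_inner G' (t \<cdot>\<^sub>m D)\<bar> \<le> N / 4 * (t * N) + N / 4 * (t * N)"
    using d1(2)[OF H] d2(2)[OF H] unfolding nH by linarith
  also have "frob_inner G (t \<cdot>\<^sub>m D) - frob_inner G' (t \<cdot>\<^sub>m D) = t * N\<^sup>2"
    using frob_inner_diff_left[OF G G' H]
    by (simp add: N_def frob_norm_power2[OF D] frob_inner_smult_right[OF D D] flip: D_def)
  finally have "t * N\<^sup>2 \<le> t * N\<^sup>2 / 2" using t N by (simp add: power2_eq_square abs_mult mult_ac)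
  moreover have "t * N\<^sup>2 > 0" using t N by simp
  ultimately show False by linarith
qed

lemma gradient_eq:
  assumes "has_gradient_on (carrier_mat m n) f G X"
  shows "gradient m n f X = G"
  unfolding gradient_def using assms has_gradient_on_unique by blast

text \<open>The chain rule for the Gram map: its increment at \<open>X\<close> is a linear part
  \<open>A + B\<close>, with \<open>B\<close> the transpose of \<open>A\<close>, plus a quadratic
  part \<open>C\<close>. As \<open>G\<close> is symmetric, \<open>A\<close> and \<open>B\<close>
  contribute equally, hence the factor 2. The lemma serves to show that \<open>gradient\<close> of
  the factored loss denotes a matrix of the right dimensions.\<close>

lemma has_gradient_on_gram:
  assumes X: "X \<in> carrier_mat d r"
    and loss: "has_gradient_on (sym_mats d) loss G (X * transpose_mat X)"
  shows "has_gradient_on (carrier_mat d r) (\<lambda>F. loss (F * transpose_mat F)) (2 \<cdot>\<^sub>m (G * X)) X"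
  unfolding has_gradient_on_def
proof (intro conjI allI impI)
  have Gs: "G \<in> sym_mats d" using loss by (simp add: has_gradient_on_def)
  then have G: "G \<in> carrier_mat d d" and GT: "transpose_mat G = G" by (auto simp: sym_mats_def)
  show "X \<in> carrier_mat d r" "2 \<cdot>\<^sub>m (G * X) \<in> carrier_mat d r" using X G by auto
  fix e :: real
  assume e: "e > 0"
  define N where "N = frob_norm X"
  define g where "g = frob_norm G"
  have N: "N \<ge> 0" and g: "g \<ge> 0" using frob_norm_nonneg[OF X] frob_norm_nonneg[OF G]
    by (simp_all add: N_def g_def)
  define e1 where "e1 = e / (2 * (2 * N + 1))"
  have e1: "e1 > 0" using e N by (simp add: e1_def)
  obtain \<delta>1 where d1: "\<delta>1 > 0" "\<And>H. H \<in> sym_mats d \<Longrightarrow> frob_norm H < \<delta>1 \<Longrightarrow>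
      \<bar>loss (X * transpose_mat X + H) - loss (X * transpose_mat X) - frob_inner G H\<bar> \<le> e1 * frob_norm H"
    using loss e1 unfolding has_gradient_on_def by blast
  \<comment> \<open>The bound 1 makes the quadratic part at most linear in \<open>h\<close>, so that
    \<open>K\<close> has norm at most \<open>(2 * N + 1) * h\<close>; the second entry then puts
    \<open>K\<close> within the range of the hypothesis on \<open>loss\<close>; the third bounds the
    contribution of \<open>C\<close> by \<open>e / 2 * h\<close>. The choice of \<open>e1\<close>
    yields the other half of \<open>e\<close>.\<close>
  define \<delta> where "\<delta> = min 1 (min (\<delta>1 / (2 * N + 1)) (e / (2 * (g + 1))))"
  have "\<delta> > 0" using d1 N g e by (simp add: \<delta>_def)
  moreover have "\<bar>loss ((X + H) * transpose_mat (X + H)) - loss (X * transpose_mat X)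
        - frob_inner (2 \<cdot>\<^sub>m (G * X)) H\<bar> \<le> e * frob_norm H"
    if H: "H \<in> carrier_mat d r" and small: "frob_norm H < \<delta>" for H
  proof -
    define h where "h = frob_norm H"
    have h: "h \<ge> 0" "h < 1" "h < \<delta>1 / (2 * N + 1)" "h < e / (2 * (g + 1))"
      using small frob_norm_nonneg[OF H] by (simp_all add: h_def \<delta>_def)
    have XT: "transpose_mat X \<in> carrier_mat r d" and HT: "transpose_mat H \<in> carrier_mat r d"
      using X H by auto
    define A where "A = X * transpose_mat H"
    define B where "B = H * transpose_mat X"
    define C where "C = H * transpose_mat H"
    have cA: "A \<in> carrier_mat d d" and cB: "B \<in> carrier_mat d d" and cC: "C \<in> carrier_mat d d"
      using X H by (auto simp: A_def B_def C_def)
    have AT: "transpose_mat A = B" and BT: "transpose_mat B = A" and CT: "transpose_mat C = C"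
      using X H by (simp_all add: A_def B_def C_def transpose_mult[OF X HT] transpose_mult[OF H XT]
          transpose_mult[OF H HT])
    define K where "K = A + B + C"
    have cK: "K \<in> carrier_mat d d" using cA cB cC by (simp add: K_def)
    have "transpose_mat K = B + A + C"
      unfolding K_def using cA cB cC by (simp add: transpose_add[of _ d d] AT BT CT)
    also have "\<dots> = K" unfolding K_def using cA cB by (simp add: comm_add_mat[of A d d B])
    finally have Ks: "K \<in> sym_mats d" using cK by (simp add: sym_mats_def)
    have expand: "(X + H) * transpose_mat (X + H) = X * transpose_mat X + K"
    proof -
      have "(X + H) * transpose_mat (X + H) = X * (transpose_mat X + transpose_mat H)
          + H * (transpose_mat X + transpose_mat H)"
        using X H by (simp add: transpose_add[OF X H] add_mult_distrib_mat[of X d r H _ d])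
      also have "\<dots> = (X * transpose_mat X + A) + (B + C)"
        by (simp add: A_def B_def C_def mult_add_distrib_mat[OF X XT HT] mult_add_distrib_mat[OF H XT HT])
      also have "\<dots> = X * transpose_mat X + K"
        unfolding K_def using X cA cB cC by (intro eq_matI) auto
      finally show ?thesis .
    qed
    have nA: "frob_norm A \<le> N * h" and nB: "frob_norm B \<le> N * h" and nC: "frob_norm C \<le> h * h"
      using frob_norm_mult_le[OF X HT] frob_norm_mult_le[OF H XT] frob_norm_mult_le[OF H HT]
      by (simp_all add: A_def B_def C_def N_def h_def frob_norm_transpose[OF X]
          frob_norm_transpose[OF H] mult.commute)
    have "frob_norm K \<le> frob_norm A + frob_norm B + frob_norm C"
      using frob_norm_add_le[of "A + B" d d C] frob_norm_add_le[OF cA cB] cA cB cC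
      by (simp add: K_def)
    also have "\<dots> \<le> N * h + N * h + h * h" using nA nB nC by simp
    also have "h * h \<le> 1 * h" using h by (intro mult_right_mono) auto
    finally have nK: "frob_norm K \<le> (2 * N + 1) * h" by (simp add: algebra_simps)
    also have "\<dots> < \<delta>1" using h N by (simp add: field_simps)
    finally have b1: "\<bar>loss (X * transpose_mat X + K) - loss (X * transpose_mat X) - frob_inner G K\<bar>
        \<le> e1 * frob_norm K" by (rule d1(2)[OF Ks])
    also have "\<dots> \<le> e1 * ((2 * N + 1) * h)" using nK e1 by (intro mult_left_mono) auto
    also have "\<dots> = e / 2 * h" using N by (simp add: e1_def field_simps)
    finally have b1: "\<bar>loss (X * transpose_mat X + K) - loss (X * transpose_mat X) - frob_inner G K\<bar>
        \<le> e / 2 * h" .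
    have GX: "G * X \<in> carrier_mat d r" using G X by simp
    have iB: "frob_inner G B = frob_inner (G * X) H"
      unfolding B_def by (rule frob_inner_mult_transpose[OF G H X])
    have iA: "frob_inner G A = frob_inner (G * X) H"
      using frob_inner_transpose[OF G cA] iB by (simp add: GT AT)
    have "frob_inner G K = frob_inner (2 \<cdot>\<^sub>m (G * X)) H + frob_inner G C"
      using cA cB cC G by (simp add: K_def frob_inner_add_right[of _ d d] iA iB
          frob_inner_smult_left[OF GX H])
    moreover have "\<bar>frob_inner G C\<bar> \<le> e / 2 * h"
    proof -
      have "\<bar>frob_inner G C\<bar> \<le> g * frob_norm C"
        unfolding g_def by (rule abs_frob_inner_le[OF G cC])
      also have "\<dots> \<le> g * (h * h)" using nC g by (rule mult_left_mono)
      also have "\<dots> \<le> ((g + 1) * h) * h" using h g by (simp add: algebra_simps)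
      also have "(g + 1) * h \<le> e / 2" using h(4) g by (simp add: field_simps)
      finally show ?thesis using h by (simp add: mult_right_mono)
    qed
    ultimately show ?thesis using b1 unfolding expand h_def[symmetric] by linarith
  qed
  ultimately show "\<exists>\<delta>>0. \<forall>H\<in>carrier_mat d r. frob_norm H < \<delta> \<longrightarrow>
      \<bar>loss ((X + H) * transpose_mat (X + H)) - loss (X * transpose_mat X)
        - frob_inner (2 \<cdot>\<^sub>m (G * X)) H\<bar> \<le> e * frob_norm H"
    by blast
qed

lemma gradient_gram_carrier:
  assumes "\<forall>X\<in>sym_mats d. \<exists>G. has_gradient_on (sym_mats d) loss G X"
    and X: "X \<in> carrier_mat d r"
  shows "gradient d r (\<lambda>F. loss (F * transpose_mat F)) X \<in> carrier_mat d r"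
proof -
  have "transpose_mat (X * transpose_mat X) = X * transpose_mat X"
    using X by (subst transpose_mult[of _ d r _ d]) auto
  then have "X * transpose_mat X \<in> sym_mats d" using X by (auto simp: sym_mats_def)
  then obtain G where "has_gradient_on (sym_mats d) loss G (X * transpose_mat X)"
    using assms(1) by blast
  from has_gradient_on_gram[OF X this] show ?thesis
    using gradient_eq by (metis has_gradient_on_def)
qed

subsection \<open>Projected gradient steps\<close>

lemma proj_onto_nearest:
  assumes "proj_well_defined m n S" "Y \<in> carrier_mat m n"
  shows "proj_onto S Y \<in> nearest_points S Y"
  using assms unfolding proj_well_defined_def proj_onto_def by (metis (no_types, lifting) theI')

text \<open>If the inner product were negative, a short move from \<open>P\<close> towards
  \<open>A\<close>, which stays in \<open>S\<close> by convexity, would come closer to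
  \<open>Y\<close>.\<close>

lemma nearest_points_variational:
  assumes S: "S \<subseteq> carrier_mat m n" "convex_mats S" and Y: "Y \<in> carrier_mat m n"
    and P: "P \<in> nearest_points S Y" and A: "A \<in> S"
  shows "0 \<le> frob_inner (P - Y) (A - P)"
proof (rule ccontr)
  have PS: "P \<in> S" using P by (simp add: nearest_points_def)
  have cP: "P \<in> carrier_mat m n" and cA: "A \<in> carrier_mat m n" using PS A S by auto
  have PY: "P - Y \<in> carrier_mat m n" and AP: "A - P \<in> carrier_mat m n"
    using Y cP by (auto intro: minus_carrier_mat)
  define k where "k = frob_inner (P - Y) (A - P)"
  define N where "N = (frob_norm (A - P))\<^sup>2"
  assume "\<not> ?thesis"
  then have k: "k < 0" by (simp add: k_def)
  have N: "N \<ge> 0" by (simp add: N_def)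
  \<comment> \<open>The fraction is chosen to give \<open>u * N \<le> - k\<close>: then the change
    of the squared distance, \<open>u * (2 * k + u * N)\<close>, is at most \<open>u * k\<close> and
    so negative.\<close>
  define u where "u = min 1 (- k / (N + 1))"
  have u: "0 < u" "u \<le> 1" using k N by (auto simp: u_def divide_neg_pos)
  have "u * N \<le> - k / (N + 1) * N" using N by (intro mult_right_mono) (auto simp: u_def)
  also have "\<dots> \<le> - k" using k N by (simp add: field_simps)
  finally have uN: "u * N \<le> - k" .
  define Q where "Q = (1 - u) \<cdot>\<^sub>m P + u \<cdot>\<^sub>m A"
  have "Q \<in> S" using S(2) PS A u unfolding convex_mats_def Q_def by auto
  then have "frob_norm (P - Y) \<le> frob_norm (Q - Y)" using P by (auto simp: nearest_points_def)
  then have "(frob_norm (P - Y))\<^sup>2 \<le> (frob_norm (Q - Y))\<^sup>2"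
    using frob_norm_nonneg[OF PY] by (intro power_mono)
  also have "Q - Y = (P - Y) + u \<cdot>\<^sub>m (A - P)"
    unfolding Q_def using cP cA Y by (intro eq_matI) (auto simp: algebra_simps)
  also have "(frob_norm \<dots>)\<^sup>2 = (frob_norm (P - Y))\<^sup>2 + 2 * u * k + u\<^sup>2 * N"
    using u AP PY by (subst frob_norm_add_power2[of _ m n])
      (auto simp: frob_norm_smult[of _ m n] frob_inner_smult_right[of _ m n] k_def N_def power_mult_distrib)
  finally have "0 \<le> u * (2 * k + u * N)" by (simp add: algebra_simps power2_eq_square)
  then have "0 \<le> 2 * k + u * N" using u by (simp add: zero_le_mult_iff)
  then show False using uN k by linarith
qed

text \<open>The variational inequality, rewritten by expanding the square of
  \<open>A - X = (P - X) + (A - P)\<close>. The negative squared step length is kept, since it later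
  pays for the displacement of the nearest factor and for the cross terms.\<close>

lemma projected_step:
  assumes S: "S \<subseteq> carrier_mat m n" "convex_mats S" and X: "X \<in> S" and G: "G \<in> carrier_mat m n"
    and P: "P \<in> nearest_points S (X - \<eta> \<cdot>\<^sub>m G)"  and A: "A \<in> S"
  shows "(frob_norm (P - A))\<^sup>2
    \<le> (frob_norm (X - A))\<^sup>2 - (frob_norm (P - X))\<^sup>2 - 2 * \<eta> * frob_inner G (P - A)"
proof -
  have PS: "P \<in> S" using P by (simp add: nearest_points_def)
  have cP: "P \<in> carrier_mat m n" and cA: "A \<in> carrier_mat m n" and cX: "X \<in> carrier_mat m n"
    using PS A S X by auto
  have PX: "P - X \<in> carrier_mat m n" and PA: "P - A \<in> carrier_mat m n" and AP: "A - P \<in> carrier_mat m n"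
    and cY: "X - \<eta> \<cdot>\<^sub>m G \<in> carrier_mat m n" and cG: "\<eta> \<cdot>\<^sub>m G \<in> carrier_mat m n"
    using G cX cA cP by (auto intro: minus_carrier_mat)
  have "0 \<le> frob_inner (P - (X - \<eta> \<cdot>\<^sub>m G)) (A - P)"
    by (rule nearest_points_variational[OF S cY P A])
  also have "P - (X - \<eta> \<cdot>\<^sub>m G) = (P - X) + \<eta> \<cdot>\<^sub>m G"
    using cP cX G by (intro eq_matI) auto
  also have "frob_inner \<dots> (A - P) = frob_inner (P - X) (A - P) + \<eta> * frob_inner G (A - P)"
    using frob_inner_add_left[OF PX cG AP] frob_inner_smult_left[OF G AP] by simp
  also have "frob_inner G (A - P) = - frob_inner G (P - A)"
    using frob_inner_diff_right[OF cA cP G] frob_inner_diff_right[OF cP cA G] by simp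
  finally have "0 \<le> frob_inner (P - X) (A - P) - \<eta> * frob_inner G (P - A)" by simp
  moreover have "A - X = (P - X) + (A - P)" using cP cX cA by (intro eq_matI) auto
  then have "(frob_norm (A - X))\<^sup>2
      = (frob_norm (P - X))\<^sup>2 + 2 * frob_inner (P - X) (A - P) + (frob_norm (A - P))\<^sup>2"
    using frob_norm_add_power2[OF PX AP] by simp
  ultimately show ?thesis
    using frob_norm_minus_commute[OF cA cX] frob_norm_minus_commute[OF cA cP] by simp
qed

text \<open>Take the old point \<open>X\<close> itself as the comparison point of the preceding
  inequality, then apply Cauchy-Schwarz and cancel one factor.\<close>

lemma projected_step_length:
  assumes S: "S \<subseteq> carrier_mat m n" "convex_mats S" and X: "X \<in> S" and G: "G \<in> carrier_mat m n"
    and P: "P \<in> nearest_points S (X - \<eta> \<cdot>\<^sub>m G)" and "0 \<le> \<eta>"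
  shows "frob_norm (P - X) \<le> \<eta> * frob_norm G"
proof -
  have cP: "P \<in> carrier_mat m n" and cX: "X \<in> carrier_mat m n"
    using P X S by (auto simp: nearest_points_def)
  have PX: "P - X \<in> carrier_mat m n" using cX by (rule minus_carrier_mat)
  define x where "x = frob_norm (P - X)"
  have x: "x \<ge> 0" using frob_norm_nonneg[OF PX] by (simp add: x_def)
  have "X - X = 0\<^sub>m m n" using cX by simp
  then have "x\<^sup>2 \<le> - \<eta> * frob_inner G (P - X)"
    using projected_step[OF S X G P X] by (simp add: x_def)
  also have "- \<eta> * frob_inner G (P - X) \<le> \<eta> * \<bar>frob_inner G (P - X)\<bar>"
    using \<open>0 \<le> \<eta>\<close> by (simp add: abs_if mult_nonneg_nonpos2 mult_nonneg_nonpos)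
  also have "\<dots> \<le> \<eta> * (frob_norm G * x)"
    unfolding x_def using \<open>0 \<le> \<eta>\<close> abs_frob_inner_le[OF G PX] by (intro mult_left_mono)
  finally have "x * x \<le> \<eta> * frob_norm G * x" by (simp add: power2_eq_square mult.assoc)
  moreover have "0 \<le> \<eta> * frob_norm G" using \<open>0 \<le> \<eta>\<close> frob_norm_nonneg[OF G] by simp
  ultimately show ?thesis using x unfolding x_def[symmetric]
    by (cases "x = 0") (auto simp: mult_le_cancel_right)
qed

subsection \<open>Factors with orthogonal columns\<close>

lemma equiv_factorsD:
  assumes "A \<in> equiv_factors d r M"
  shows "A \<in> carrier_mat d r" "A * transpose_mat A = M"
    "\<And>i j. i < r \<Longrightarrow> j < r \<Longrightarrow> i \<noteq> j \<Longrightarrow> (transpose_mat A * A) $$ (i, j) = 0"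
  using assms by (auto simp: equiv_factors_def)

section \<open>Products with diagonal matrices and columnwise inner products\<close>

lemma diagonal_mult_left:
  assumes "D \<in> carrier_mat r r" "C \<in> carrier_mat r n" "i < r" "j < n"
    and "\<And>k. k < r \<Longrightarrow> k \<noteq> i \<Longrightarrow> D $$ (i, k) = 0"
  shows "(D * C) $$ (i, j) = D $$ (i, i) * C $$ (i, j)"
proof -
  have "(D * C) $$ (i, j) = (\<Sum>k<r. D $$ (i, k) * C $$ (k, j))"
    using assms by (simp add: scalar_prod_def atLeast0LessThan)
  also have "\<dots> = (\<Sum>k<r. if k = i then D $$ (i, i) * C $$ (i, j) else 0)"
    using assms(5) by (intro sum.cong) auto
  finally show ?thesis using assms(3) by simp
qed

lemma diagonal_mult_right:
  assumes "C \<in> carrier_mat n r" "D \<in> carrier_mat r r" "i < n" "j < r"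
    and "\<And>k. k < r \<Longrightarrow> k \<noteq> j \<Longrightarrow> D $$ (k, j) = 0"
  shows "(C * D) $$ (i, j) = C $$ (i, j) * D $$ (j, j)"
proof -
  have "(C * D) $$ (i, j) = (\<Sum>k<r. C $$ (i, k) * D $$ (k, j))"
    using assms by (simp add: scalar_prod_def atLeast0LessThan)
  also have "\<dots> = (\<Sum>k<r. if k = j then C $$ (i, j) * D $$ (j, j) else 0)"
    using assms(5) by (intro sum.cong) auto
  finally show ?thesis using assms(4) by simp
qed

lemma frob_inner_col_sum:
  assumes "A \<in> carrier_mat m n" "B \<in> carrier_mat m n"
  shows "frob_inner A B = (\<Sum>j<n. col A j \<bullet> col B j)"
proof -
  have "frob_inner A B = (\<Sum>j<n. \<Sum>i<m. A $$ (i, j) * B $$ (i, j))"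
    by (subst sum.swap) (simp add: frob_inner_double_sum[OF assms])
  then show ?thesis using assms by (simp add: scalar_prod_def atLeast0LessThan)
qed

text \<open>Both sides are the trace of \<open>M\<close>. Hence all factors lie on one sphere around
  the origin.\<close>

lemma frob_norm_equiv_factors:
  assumes A: "A \<in> equiv_factors d r M"
  shows "(frob_norm A)\<^sup>2 = frob_inner (1\<^sub>m d) M"
proof -
  have c: "A \<in> carrier_mat d r" using A by (rule equiv_factorsD)
  have "frob_inner (1\<^sub>m d) (A * transpose_mat A) = frob_inner (1\<^sub>m d * A) A"
    by (rule frob_inner_mult_transpose[OF _ c c]) simp
  then show ?thesis using c equiv_factorsD(2)[OF A] by (simp add: frob_norm_power2[OF c])
qed

text \<open>The matrix \<open>transpose_mat P * A\<close> intertwines the two diagonal Gram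
  matrices, because both products equal \<open>transpose_mat P * M * A\<close>. In other words,
  nonzero columns of factors are eigenvectors of \<open>M\<close> with their squared norms as
  eigenvalues, and eigenvectors for different eigenvalues are orthogonal.\<close>

lemma equiv_factors_cross_gram:
  assumes P: "P \<in> equiv_factors d r M" and A: "A \<in> equiv_factors d r M" and ij: "i < r" "j < r"
    and ne: "(transpose_mat P * P) $$ (i, i) \<noteq> (transpose_mat A * A) $$ (j, j)"
  shows "(transpose_mat P * A) $$ (i, j) = 0"
proof -
  have cP: "P \<in> carrier_mat d r" and cA: "A \<in> carrier_mat d r" using P A by (auto dest: equiv_factorsD)
  have cPT: "transpose_mat P \<in> carrier_mat r d" and cAT: "transpose_mat A \<in> carrier_mat r d"
    using cP cA by auto
  have C: "transpose_mat P * A \<in> carrier_mat r r" and DP: "transpose_mat P * P \<in> carrier_mat r r"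
    and DA: "transpose_mat A * A \<in> carrier_mat r r" using cP cA by auto
  have "(transpose_mat P * P) * (transpose_mat P * A) = transpose_mat P * ((P * transpose_mat P) * A)"
    using cP cA by (simp add: assoc_mult_mat[of _ r d _ r _ r] assoc_mult_mat[of _ d r _ d _ r])
  also have "P * transpose_mat P = A * transpose_mat A"
    using equiv_factorsD(2)[OF P] equiv_factorsD(2)[OF A] by simp
  also have "transpose_mat P * ((A * transpose_mat A) * A) = (transpose_mat P * A) * (transpose_mat A * A)"
    using cP cA by (simp add: assoc_mult_mat[of _ r d _ r _ r] assoc_mult_mat[of _ d r _ d _ r])
  finally have "(transpose_mat P * P) $$ (i, i) * (transpose_mat P * A) $$ (i, j)
      = (transpose_mat P * A) $$ (i, j) * (transpose_mat A * A) $$ (j, j)"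
    using diagonal_mult_left[OF DP C ij] diagonal_mult_right[OF C DA ij]
      equiv_factorsD(3)[OF P] equiv_factorsD(3)[OF A] ij by auto
  then show ?thesis using ne by auto
qed

text \<open>With \<open>D\<close> the invertible diagonal Gram matrix of \<open>P\<close> and
  \<open>C = transpose_mat P * A\<close>, the only candidate for \<open>V\<close> is the inverse of
  \<open>D\<close> times \<open>C\<close>. It is orthogonal because
  \<open>C * transpose_mat C = D * D\<close>, and it inherits the zeros of \<open>C\<close>.\<close>

lemma equiv_factors_transfer:
  assumes P: "P \<in> equiv_factors d r M" and A: "A \<in> equiv_factors d r M"
    and pos: "\<And>i. i < r \<Longrightarrow> (transpose_mat P * P) $$ (i, i) > 0"
  obtains V where "V \<in> carrier_mat r r" "A = P * V" "V * transpose_mat V = 1\<^sub>m r"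
    "transpose_mat V * V = 1\<^sub>m r"
    "\<forall>i<r. \<forall>j<r. (transpose_mat P * P) $$ (i, i) \<noteq> (transpose_mat A * A) $$ (j, j)
      \<longrightarrow> V $$ (i, j) = 0"
proof -
  have cP: "P \<in> carrier_mat d r" and cA: "A \<in> carrier_mat d r" using P A by (auto dest: equiv_factorsD)
  have cPT: "transpose_mat P \<in> carrier_mat r d" and cAT: "transpose_mat A \<in> carrier_mat r d"
    using cP cA by auto
  define D where "D = transpose_mat P * P"
  define C where "C = transpose_mat P * A"
  define I where "I = mat r r (\<lambda>(i, j). if i = j then 1 / D $$ (i, i) else 0)"
  have cD: "D \<in> carrier_mat r r" and cC: "C \<in> carrier_mat r r" and cI: "I \<in> carrier_mat r r"
    using cP cA by (auto simp: D_def C_def I_def)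
  have cCT: "transpose_mat C \<in> carrier_mat r r" using cC by simp
  have off: "D $$ (i, j) = 0" if "i < r" "j < r" "i \<noteq> j" for i j
    using equiv_factorsD(3)[OF P that] by (simp add: D_def)
  have ID: "I * D = 1\<^sub>m r"
  proof (intro eq_matI)
    fix i j assume "i < dim_row (1\<^sub>m r)" "j < dim_col (1\<^sub>m r)"
    then have ij: "i < r" "j < r" by auto
    have "(I * D) $$ (i, j) = I $$ (i, i) * D $$ (i, j)"
      by (rule diagonal_mult_left[OF cI cD ij]) (use ij in \<open>auto simp: I_def\<close>)
    then show "(I * D) $$ (i, j) = 1\<^sub>m r $$ (i, j)"
      using ij off[of i j] pos[of i] by (auto simp: I_def D_def[symmetric])
  qed (use cI cD in auto)
  have DI: "D * I = 1\<^sub>m r" by (rule mat_mult_left_right_inverse[OF cI cD ID])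
  have IT: "transpose_mat I = I" by (intro eq_matI) (auto simp: I_def)
  define V where "V = I * C"
  have cV: "V \<in> carrier_mat r r" and cVT: "transpose_mat V \<in> carrier_mat r r"
    using cI cC by (auto simp: V_def)
  have DV: "D * V = C"
    using cI cD cC by (simp add: V_def DI flip: assoc_mult_mat[of D r r I r C r])
  have VT: "transpose_mat V = transpose_mat C * I"
    unfolding V_def by (simp add: transpose_mult[OF cI cC] IT)
  have "C * transpose_mat C = transpose_mat P * ((A * transpose_mat A) * P)"
    using cP cA by (simp add: C_def transpose_mult[of _ r d _ r] assoc_mult_mat[of _ r d _ r _ r]
        assoc_mult_mat[of _ d r _ d _ r])
  also have "A * transpose_mat A = P * transpose_mat P"
    using equiv_factorsD(2)[OF P] equiv_factorsD(2)[OF A] by simp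
  also have "transpose_mat P * ((P * transpose_mat P) * P) = D * D"
    using cP cA by (simp add: D_def assoc_mult_mat[of _ r d _ r _ r] assoc_mult_mat[of _ d r _ d _ r])
  finally have CC: "C * transpose_mat C = D * D" .
  have "V * transpose_mat V = I * (C * transpose_mat C) * I"
    by (subst VT) (use cI cC cCT in \<open>simp add: V_def assoc_mult_mat[of _ r r _ r _ r]\<close>)
  also have "\<dots> = (I * D) * (D * I)"
    unfolding CC using cI cD by (simp add: assoc_mult_mat[of _ r r _ r _ r])
  finally have VV: "V * transpose_mat V = 1\<^sub>m r" by (simp add: ID DI)
  have PV: "P * V \<in> carrier_mat d r" using cP cV by simp
  \<comment> \<open>That \<open>A\<close> equals \<open>P * V\<close> is obtained from norms: the
    inner product of the two and both squared norms all equal the squared norm of \<open>P\<close>,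
    so their difference has norm zero.\<close>
  have inner: "frob_inner C V = (frob_norm P)\<^sup>2"
  proof -
    have "frob_inner C V = frob_inner D (V * transpose_mat V)"
      using frob_inner_mult_transpose[OF cD cV cV] by (simp add: DV)
    also have "\<dots> = (frob_norm P)\<^sup>2"
      using frob_inner_mult_right[OF cP cP, of "1\<^sub>m r"] cP by (simp add: VV D_def frob_norm_power2[OF cP])
    finally show ?thesis .
  qed
  have "frob_inner A (P * V) = (frob_norm P)\<^sup>2"
    using frob_inner_mult_right[OF cA cP cV] inner by (simp add: C_def)
  moreover have "(frob_norm (P * V))\<^sup>2 = (frob_norm P)\<^sup>2"
  proof -
    have "(frob_norm (P * V))\<^sup>2 = frob_inner (transpose_mat P * (P * V)) V"
      using frob_inner_mult_right[OF PV cP cV] by (simp add: frob_norm_power2[OF PV])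
    also have "transpose_mat P * (P * V) = C"
      using DV cP cV by (simp add: D_def)
    finally show ?thesis using inner by simp
  qed
  moreover have "(frob_norm A)\<^sup>2 = (frob_norm P)\<^sup>2"
    by (simp add: frob_norm_equiv_factors[OF A] frob_norm_equiv_factors[OF P])
  ultimately have "frob_norm (A - P * V) = 0"
    using frob_norm_diff_power2[OF cA PV] by simp
  then have "A = P * V" by (rule frob_norm_diff_eq_0D[OF cA PV])
  moreover have "transpose_mat V * V = 1\<^sub>m r" by (rule mat_mult_left_right_inverse[OF cV cVT VV])
  moreover have "V $$ (i, j) = 0" if "i < r" "j < r"
      "(transpose_mat P * P) $$ (i, i) \<noteq> (transpose_mat A * A) $$ (j, j)" for i j
  proof -
    have "V $$ (i, j) = I $$ (i, i) * C $$ (i, j)"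
      unfolding V_def by (rule diagonal_mult_left[OF cI cC that(1,2)]) (use that in \<open>auto simp: I_def\<close>)
    then show ?thesis using equiv_factors_cross_gram[OF P A that] by (simp add: C_def)
  qed
  ultimately show thesis using that[OF cV _ VV] by blast
qed

text \<open>A column of \<open>A\<close> with squared norm below \<open>s\<close> would match no
  column of \<open>P\<close> in norm, so the corresponding column of the orthogonal matrix
  \<open>V\<close> would vanish. This carries a lower bound on the column norms from one factor to
  all others.\<close>

lemma equiv_factors_gram_ge:
  assumes P: "P \<in> equiv_factors d r M" and A: "A \<in> equiv_factors d r M"
    and s: "0 < s" "\<And>i. i < r \<Longrightarrow> s \<le> (transpose_mat P * P) $$ (i, i)" and j: "j < r"
  shows "s \<le> (transpose_mat A * A) $$ (j, j)"
proof (rule ccontr)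
  assume less: "\<not> ?thesis"
  have pos: "(transpose_mat P * P) $$ (i, i) > 0" if "i < r" for i
    using s(1) s(2)[OF that] by linarith
  obtain V where V: "V \<in> carrier_mat r r" and "A = P * V" "V * transpose_mat V = 1\<^sub>m r"
    and VV: "transpose_mat V * V = 1\<^sub>m r" and V0:
      "\<forall>i<r. \<forall>j<r. (transpose_mat P * P) $$ (i, i) \<noteq> (transpose_mat A * A) $$ (j, j)
        \<longrightarrow> V $$ (i, j) = 0"
    by (rule equiv_factors_transfer[OF P A pos]) blast+
  have "V $$ (i, j) = 0" if "i < r" for i
    using V0 that j s(2)[OF that] less by auto
  then have "(transpose_mat V * V) $$ (j, j) = 0"
    using V j by (simp add: scalar_prod_def)
  then show False using VV j by simp
qed

text \<open>A rotation of two columns leaves \<open>P * transpose_mat P\<close> unchanged. The two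
  rotated columns have inner product \<open>c * s\<close> times the difference of the squared norms
  of columns \<open>j\<close> and \<open>i\<close>, so equal norms keep them orthogonal.\<close>

lemma givens_rotation_equiv_factors:
  fixes c s :: real
  assumes P: "P \<in> equiv_factors d r M" and ij: "i < r" "j < r" "i \<noteq> j"
    and eq: "(transpose_mat P * P) $$ (i, i) = (transpose_mat P * P) $$ (j, j)"
    and cs: "c\<^sup>2 + s\<^sup>2 = 1"
  obtains Q where "Q \<in> equiv_factors d r M"
    "\<And>k. k < r \<Longrightarrow> col Q k = (if k = i then c \<cdot>\<^sub>v col P i + s \<cdot>\<^sub>v col P j
       else if k = j then c \<cdot>\<^sub>v col P j - s \<cdot>\<^sub>v col P i else col P k)"
proof -
  have cP: "P \<in> carrier_mat d r" using P by (rule equiv_factorsD)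
  define Q where "Q = mat d r (\<lambda>(a, k). if k = i then c * P $$ (a, i) + s * P $$ (a, j)
    else if k = j then c * P $$ (a, j) - s * P $$ (a, i) else P $$ (a, k))"
  have cQ: "Q \<in> carrier_mat d r" by (simp add: Q_def)
  have colQ: "col Q k = (if k = i then c \<cdot>\<^sub>v col P i + s \<cdot>\<^sub>v col P j
       else if k = j then c \<cdot>\<^sub>v col P j - s \<cdot>\<^sub>v col P i else col P k)" if "k < r" for k
    using that cP ij by (intro eq_vecI) (auto simp: Q_def)
  have "Q * transpose_mat Q = P * transpose_mat P"
  proof (intro eq_matI)
    fix a b assume "a < dim_row (P * transpose_mat P)" "b < dim_col (P * transpose_mat P)"
    then have ab: "a < d" "b < d" using cP by auto
    have split: "(\<Sum>k<r. g k) = g i + g j + (\<Sum>k\<in>{..<r} - {i} - {j}. g k)" for g :: "nat \<Rightarrow> real"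
      using ij by (simp add: sum.remove[of "{..<r}" i] sum.remove[of "{..<r} - {i}" j])
    have "(Q * transpose_mat Q) $$ (a, b) = (\<Sum>k<r. Q $$ (a, k) * Q $$ (b, k))"
      using ab cQ by (simp add: scalar_prod_def atLeast0LessThan)
    also have "\<dots> = Q $$ (a, i) * Q $$ (b, i) + Q $$ (a, j) * Q $$ (b, j)
        + (\<Sum>k\<in>{..<r} - {i} - {j}. Q $$ (a, k) * Q $$ (b, k))"
      by (rule split)
    also have "Q $$ (a, i) * Q $$ (b, i) + Q $$ (a, j) * Q $$ (b, j)
        = (c\<^sup>2 + s\<^sup>2) * (P $$ (a, i) * P $$ (b, i) + P $$ (a, j) * P $$ (b, j))"
      using ab ij by (simp add: Q_def algebra_simps power2_eq_square)
    also have "(\<Sum>k\<in>{..<r} - {i} - {j}. Q $$ (a, k) * Q $$ (b, k))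
        = (\<Sum>k\<in>{..<r} - {i} - {j}. P $$ (a, k) * P $$ (b, k))"
      using ab by (intro sum.cong) (auto simp: Q_def)
    also have "(c\<^sup>2 + s\<^sup>2) * (P $$ (a, i) * P $$ (b, i) + P $$ (a, j) * P $$ (b, j)) + \<dots>
        = (\<Sum>k<r. P $$ (a, k) * P $$ (b, k))"
      unfolding cs by (simp add: split)
    also have "\<dots> = (P * transpose_mat P) $$ (a, b)"
      using ab cP by (simp add: scalar_prod_def atLeast0LessThan)
    finally show "(Q * transpose_mat Q) $$ (a, b) = (P * transpose_mat P) $$ (a, b)" .
  qed (use cP cQ in auto)
  moreover have "col Q k \<bullet> col Q l = 0" if kl: "k < r" "l < r" "k \<noteq> l" for k l
  proof -
    have orth: "col P k \<bullet> col P l = 0" if "k < r" "l < r" "k \<noteq> l" for k l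
      using equiv_factorsD(3)[OF P that] that cP by simp
    have eq': "col P i \<bullet> col P i = col P j \<bullet> col P j" using eq cP ij by simp
    have cc: "col P k \<in> carrier_vec d" for k using cP by (simp add: carrier_vecI)
    show ?thesis
      using kl ij unfolding colQ[OF kl(1)] colQ[OF kl(2)]
      by (auto simp: orth add_scalar_prod_distrib[of _ d] scalar_prod_add_distrib[of _ d]
          minus_scalar_prod_distrib[of _ d] scalar_prod_minus_distrib[of _ d] cc
          smult_carrier_vec eq')
  qed
  ultimately have "Q \<in> equiv_factors d r M"
    using cQ equiv_factorsD(2)[OF P] by (simp add: equiv_factors_def)
  then show thesis using that colQ by blast
qed

text \<open>On a sphere around the origin, minimising the distance to \<open>F\<close> is the same
  as maximising the inner product with \<open>F\<close>.\<close>

lemma nearest_equiv_factor_maximizes_inner: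
  assumes F: "F \<in> carrier_mat d r" and P: "P \<in> nearest_points (equiv_factors d r M) F"
    and A: "A \<in> equiv_factors d r M"
  shows "frob_inner F A \<le> frob_inner F P"
proof -
  have PE: "P \<in> equiv_factors d r M" and le: "frob_norm (P - F) \<le> frob_norm (A - F)"
    using P A by (auto simp: nearest_points_def)
  have cP: "P \<in> carrier_mat d r" and cA: "A \<in> carrier_mat d r" using PE A by (auto dest: equiv_factorsD)
  have "(frob_norm (P - F))\<^sup>2 \<le> (frob_norm (A - F))\<^sup>2"
    using le frob_norm_nonneg[OF minus_carrier_mat[OF F]] by (intro power_mono)
  then show ?thesis
    by (simp add: frob_norm_diff_power2[OF cP F] frob_norm_diff_power2[OF cA F]
        frob_norm_equiv_factors[OF PE] frob_norm_equiv_factors[OF A]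
        frob_inner_commute[OF cP F] frob_inner_commute[OF cA F])
qed

text \<open>First-order optimality along the Givens rotations that stay within the set of factors.\<close>

lemma nearest_equiv_factor_symmetric:
  assumes F: "F \<in> carrier_mat d r" and P: "P \<in> nearest_points (equiv_factors d r M) F"
    and ij: "i < r" "j < r"
    and eq: "(transpose_mat P * P) $$ (i, i) = (transpose_mat P * P) $$ (j, j)"
  shows "(transpose_mat P * F) $$ (i, j) = (transpose_mat P * F) $$ (j, i)"
proof (rule ccontr)
  assume ne: "\<not> ?thesis"
  then have "i \<noteq> j" by auto
  have PE: "P \<in> equiv_factors d r M" using P by (simp add: nearest_points_def)
  have cP: "P \<in> carrier_mat d r" using PE by (rule equiv_factorsD)
  have cc: "col P k \<in> carrier_vec d" "col F k \<in> carrier_vec d" for k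
    using cP F by (simp_all add: carrier_vecI)
  define S where "S = transpose_mat P * F"
  have S: "col F k \<bullet> col P l = S $$ (l, k)" if "k < r" "l < r" for k l
    using that cP F comm_scalar_prod[OF cc(2)[of k] cc(1)[of l]] by (simp add: S_def)
  \<comment> \<open>Rotating columns \<open>i\<close> and \<open>j\<close> of \<open>P\<close> by
    \<open>(c, s)\<close> changes their contribution to the inner product with \<open>F\<close> from
    \<open>a\<close> to \<open>c * a + s * b\<close>. The best rotation is \<open>(a, b) / n\<close>
    with value \<open>n\<close>, so maximality of \<open>P\<close> gives \<open>n \<le> a\<close>
    and forces \<open>b = 0\<close>.\<close>
  define a where "a = S $$ (i, i) + S $$ (j, j)"
  define b where "b = S $$ (j, i) - S $$ (i, j)"
  have b: "b \<noteq> 0" using ne by (simp add: b_def S_def)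
  define n where "n = sqrt (a\<^sup>2 + b\<^sup>2)"
  have n2: "n\<^sup>2 = a\<^sup>2 + b\<^sup>2" by (simp add: n_def)
  have n: "n > 0" using b by (simp add: n_def add_nonneg_pos)
  have "(a / n)\<^sup>2 + (b / n)\<^sup>2 = 1"
    using n by (simp add: power_divide n2[symmetric] flip: add_divide_distrib)
  then obtain Q where Q: "Q \<in> equiv_factors d r M" and colQ:
    "\<And>k. k < r \<Longrightarrow> col Q k = (if k = i then (a / n) \<cdot>\<^sub>v col P i + (b / n) \<cdot>\<^sub>v col P j
       else if k = j then (a / n) \<cdot>\<^sub>v col P j - (b / n) \<cdot>\<^sub>v col P i else col P k)"
    using givens_rotation_equiv_factors[OF PE ij \<open>i \<noteq> j\<close> eq] by metis
  have cQ: "Q \<in> carrier_mat d r" using Q by (rule equiv_factorsD)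
  have split: "(\<Sum>k<r. g k) = g i + g j + (\<Sum>k\<in>{..<r} - {i} - {j}. g k)" for g :: "nat \<Rightarrow> real"
    using ij \<open>i \<noteq> j\<close> by (simp add: sum.remove[of "{..<r}" i] sum.remove[of "{..<r} - {i}" j])
  have "frob_inner F Q \<le> frob_inner F P"
    by (rule nearest_equiv_factor_maximizes_inner[OF F P Q])
  moreover have "frob_inner F P = a + (\<Sum>k\<in>{..<r} - {i} - {j}. S $$ (k, k))"
    unfolding frob_inner_col_sum[OF F cP] split using ij S by (simp add: a_def)
  moreover have "frob_inner F Q = (a / n) * a + (b / n) * b + (\<Sum>k\<in>{..<r} - {i} - {j}. S $$ (k, k))"
  proof -
    have "frob_inner F Q = col F i \<bullet> col Q i + col F j \<bullet> col Q j
        + (\<Sum>k\<in>{..<r} - {i} - {j}. col F k \<bullet> col Q k)"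
      unfolding frob_inner_col_sum[OF F cQ] by (rule split)
    also have "col F i \<bullet> col Q i = (a / n) * S $$ (i, i) + (b / n) * S $$ (j, i)"
      using ij S by (simp add: colQ scalar_prod_add_distrib[of _ d] scalar_prod_smult_distrib[of _ d] cc)
    also have "col F j \<bullet> col Q j = (a / n) * S $$ (j, j) - (b / n) * S $$ (i, j)"
      using ij S \<open>i \<noteq> j\<close> by (simp add: colQ scalar_prod_minus_distrib[of _ d] scalar_prod_smult_distrib[of _ d] cc)
    also have "(\<Sum>k\<in>{..<r} - {i} - {j}. col F k \<bullet> col Q k) = (\<Sum>k\<in>{..<r} - {i} - {j}. S $$ (k, k))"
      using S colQ by (intro sum.cong) auto
    finally have "frob_inner F Q = (a / n) * (S $$ (i, i) + S $$ (j, j))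
        + (b / n) * (S $$ (j, i) - S $$ (i, j)) + (\<Sum>k\<in>{..<r} - {i} - {j}. S $$ (k, k))"
      by (simp add: distrib_left right_diff_distrib del: times_divide_eq_left)
    then show ?thesis unfolding a_def[symmetric] b_def[symmetric] .
  qed
  moreover have "(a / n) * a + (b / n) * b = n"
    using n n2 by (simp add: field_simps power2_eq_square)
  ultimately have "n \<le> a" by simp
  then have "n\<^sup>2 \<le> a\<^sup>2" using n by (intro power_mono) auto
  then show False using n2 b by simp
qed

text \<open>A quantitative form of the maximality of \<open>P\<close>. For \<open>F = P\<close>
  equal norms give the bound with constant 1/2; replacing \<open>P\<close> by \<open>F\<close>
  perturbs it by at most the fraction \<open>1 - \<theta>\<close>, either because \<open>A\<close>
  is far from \<open>P\<close>, or because the symmetry of \<open>S\<close> turns the inner product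
  into a second-order expression.\<close>

lemma nearest_equiv_factor_growth:
  assumes F: "F \<in> carrier_mat d r" and P: "P \<in> nearest_points (equiv_factors d r M) F"
    and A: "A \<in> equiv_factors d r M" and s: "0 < s"
    and sP: "\<And>i. i < r \<Longrightarrow> s\<^sup>2 \<le> (transpose_mat P * P) $$ (i, i)"
    and near: "frob_norm (F - P) \<le> (1 - \<theta>) * s"
  shows "\<theta> / 2 * (frob_norm (P - A))\<^sup>2 \<le> frob_inner F (P - A)"
proof -
  have PE: "P \<in> equiv_factors d r M" using P by (simp add: nearest_points_def)
  have s2: "0 < s\<^sup>2" using s by simp
  have sA: "s\<^sup>2 \<le> (transpose_mat A * A) $$ (i, i)" if "i < r" for i
    using equiv_factors_gram_ge[OF PE A s2 sP that] .
  have cP: "P \<in> carrier_mat d r" and cA: "A \<in> carrier_mat d r" using PE A by (auto dest: equiv_factorsD)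
  have PA: "P - A \<in> carrier_mat d r" and FP: "F - P \<in> carrier_mat d r"
    using cA cP by (auto intro: minus_carrier_mat)
  define N where "N = frob_norm (P - A)"
  have N: "N \<ge> 0" using frob_norm_nonneg[OF PA] by (simp add: N_def)
  \<comment> \<open>The proximity bound itself forces \<theta> to be at most 1.\<close>
  have "0 \<le> (1 - \<theta>) * s" using near frob_norm_nonneg[OF FP] by linarith
  then have \<theta>: "0 \<le> 1 - \<theta>" using s by (simp add: zero_le_mult_iff)
  define p where "p i = (transpose_mat P * P) $$ (i, i)" for i
  define a where "a i = (transpose_mat A * A) $$ (i, i)" for i
  have p: "p i = col P i \<bullet> col P i" and a: "a i = col A i \<bullet> col A i" if "i < r" for i
    using that cP cA by (auto simp: p_def a_def)
  show ?thesis
  proof (cases "\<exists>i<r. p i \<noteq> a i")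
    case True
    then obtain i where i: "i < r" "p i \<noteq> a i" by blast
    \<comment> \<open>The squared column norms of both factors add up to the trace of
      \<open>M\<close>, so a mismatch in one column forces a mismatch in a second one. Each
      mismatched pair of columns is orthogonal and contributes at least
      \<open>2 * s\<^sup>2\<close>; two of them give \<open>(2 * s)\<^sup>2\<close>.\<close>
    have "(\<Sum>k<r. p k - a k) = 0"
      using frob_norm_equiv_factors[OF PE] frob_norm_equiv_factors[OF A]
      by (simp add: frob_norm_power2[OF cP] frob_norm_power2[OF cA] frob_inner_col_sum[OF cP cP]
          frob_inner_col_sum[OF cA cA] sum_subtractf p a)
    then have "(\<Sum>k\<in>{..<r} - {i}. p k - a k) \<noteq> 0"
      using i sum.remove[of "{..<r}" i "\<lambda>k. p k - a k"] by simp
    then obtain j where "j \<in> {..<r} - {i}" "p j - a j \<noteq> 0"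
      by (rule sum.not_neutral_contains_not_neutral)
    then have j: "j < r" "j \<noteq> i" "p j \<noteq> a j" by auto
    have col_ge: "2 * s\<^sup>2 \<le> col (P - A) k \<bullet> col (P - A) k" if k: "k < r" "p k \<noteq> a k" for k
    proof -
      have ck: "col P k \<in> carrier_vec d" "col A k \<in> carrier_vec d"
        using cP cA by (simp_all add: carrier_vecI)
      have "(transpose_mat P * A) $$ (k, k) = 0"
        using equiv_factors_cross_gram[OF PE A k(1) k(1)] k(2) by (simp add: p_def a_def)
      then have 0: "col P k \<bullet> col A k = 0" "col A k \<bullet> col P k = 0"
        using k cP cA comm_scalar_prod[OF ck] by auto
      have "col (P - A) k = col P k - col A k" using k cP cA by (intro eq_vecI) auto
      then have "col (P - A) k \<bullet> col (P - A) k = p k + a k"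
        using ck k(1) by (simp add: minus_scalar_prod_distrib[of _ d] scalar_prod_minus_distrib[of _ d]
            0 p a minus_carrier_vec)
      then show ?thesis using sP[OF k(1)] sA[OF k(1)] by (simp add: p_def a_def)
    qed
    have "(2 * s)\<^sup>2 = 2 * s\<^sup>2 + 2 * s\<^sup>2" by (simp add: power_mult_distrib)
    also have "\<dots> \<le> (\<Sum>k\<in>{i, j}. col (P - A) k \<bullet> col (P - A) k)"
      using col_ge[OF i] col_ge[OF j(1,3)] j(2) by simp
    also have "\<dots> \<le> (\<Sum>k<r. col (P - A) k \<bullet> col (P - A) k)"
      using i j by (intro sum_mono2) (auto simp: scalar_prod_def sum_nonneg)
    also have "\<dots> = N\<^sup>2" by (simp add: N_def frob_norm_power2[OF PA] frob_inner_col_sum[OF PA PA])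
    finally have sN: "2 * s \<le> N" using N by (rule power2_le_imp_le)
    have "\<bar>frob_inner (F - P) (P - A)\<bar> \<le> (1 - \<theta>) * s * N"
      using abs_frob_inner_le[OF FP PA] mult_right_mono[OF near N] by (simp add: N_def)
    also have "\<dots> \<le> (1 - \<theta>) * (N / 2) * N"
      using sN \<theta> N by (intro mult_right_mono mult_left_mono) auto
    finally have "- frob_inner (F - P) (P - A) \<le> (1 - \<theta>) / 2 * N\<^sup>2"
      by (simp add: power2_eq_square)
    moreover have "frob_inner (F - P) (P - A) = frob_inner F (P - A) - frob_inner P (P - A)"
      by (rule frob_inner_diff_left[OF F cP PA])
    moreover have "frob_inner P (P - A) = N\<^sup>2 / 2"
      unfolding N_def frob_norm_diff_power2[OF cP cA] frob_inner_diff_right[OF cP cA cP]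
      using frob_norm_equiv_factors[OF PE] frob_norm_equiv_factors[OF A]
      by (simp add: frob_norm_power2[OF cP])
    ultimately show ?thesis unfolding N_def[symmetric] by (simp add: field_simps)
  next
    case False
    then have pa: "p i = a i" if "i < r" for i using that by blast
    have pos: "(transpose_mat P * P) $$ (i, i) > 0" if "i < r" for i
      using s2 sP[OF that] by linarith
    obtain V where cV: "V \<in> carrier_mat r r" and AV: "A = P * V" and VV: "V * transpose_mat V = 1\<^sub>m r"
      and "transpose_mat V * V = 1\<^sub>m r" and V0:
        "\<forall>i<r. \<forall>j<r. (transpose_mat P * P) $$ (i, i) \<noteq> (transpose_mat A * A) $$ (j, j)
          \<longrightarrow> V $$ (i, j) = 0"
      by (rule equiv_factors_transfer[OF PE A pos]) blast+
    define W where "W = 1\<^sub>m r - V"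
    have cW: "W \<in> carrier_mat r r" unfolding W_def using cV by (rule minus_carrier_mat)
    have cWT: "transpose_mat W \<in> carrier_mat r r" using cW by simp
    have cVT: "transpose_mat V \<in> carrier_mat r r" using cV by simp
    have PW: "P - A = P * W"
      unfolding W_def AV using cP cV by (simp add: mult_minus_distrib_mat[of P d r "1\<^sub>m r" r V])
    have WT: "transpose_mat W = 1\<^sub>m r - transpose_mat V"
      unfolding W_def using cV by (intro eq_matI) auto
    \<comment> \<open>For orthogonal \<open>V\<close> this is the expansion of
      \<open>(1 - V)(1 - V^T) = 2 - V - V^T\<close>.\<close>
    have WW: "W * transpose_mat W = W + transpose_mat W"
    proof -
      have "W * transpose_mat W = W * (1\<^sub>m r) - W * transpose_mat V"
        unfolding WT using cW cVT by (intro mult_minus_distrib_mat) auto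
      also have "W * transpose_mat V = transpose_mat V - 1\<^sub>m r"
        unfolding W_def using cV cVT by (simp add: minus_mult_distrib_mat[of _ r r] VV)
      finally show ?thesis unfolding WT using cW cV by (intro eq_matI) auto
    qed
    define S where "S = transpose_mat P * F"
    have cS: "S \<in> carrier_mat r r" using cP F by (simp add: S_def)
    \<comment> \<open>Symmetry of \<open>S\<close> is known only between columns of equal norm.
      Elsewhere \<open>W\<close> vanishes, since \<open>V\<close> does and the entry lies off the
      diagonal.\<close>
    have SW: "S $$ (i, j) * W $$ (i, j) = S $$ (j, i) * W $$ (i, j)" if ij: "i < r" "j < r" for i j
    proof (cases "p i = p j")
      case True
      then show ?thesis
        using nearest_equiv_factor_symmetric[OF F P ij] by (simp add: p_def S_def)
    next
      case False
      then have "V $$ (i, j) = 0" using V0 ij pa[OF ij(2)] by (simp add: p_def a_def)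
      then have "W $$ (i, j) = 0" using False ij cV by (auto simp: W_def)
      then show ?thesis by simp
    qed
    have cST: "transpose_mat S \<in> carrier_mat r r" using cS by simp
    have "frob_inner S W = frob_inner (transpose_mat S) W"
      unfolding frob_inner_double_sum[OF cS cW] frob_inner_double_sum[OF cST cW]
      using cS SW by (intro sum.cong refl) auto
    also have "\<dots> = frob_inner S (transpose_mat W)"
      using frob_inner_transpose[OF cS cWT] by simp
    \<comment> \<open>Here the first-order quantity \<open>frob_inner S W\<close>, which is the one
      to be bounded, becomes quadratic in \<open>W\<close>.\<close>
    finally have "2 * frob_inner S W = frob_inner S (W * transpose_mat W)"
      unfolding WW frob_inner_add_right[OF cW cWT cS] by simp
    also have "\<dots> = frob_inner (S * W) W" by (rule frob_inner_mult_transpose[OF cS cW cW])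
    also have "S * W = transpose_mat P * (F * W)" unfolding S_def using cP F cW by simp
    also have "frob_inner \<dots> W = frob_inner (F * W) (P * W)"
      using frob_inner_mult_right[of "F * W" d r P r W] F cW cP by simp
    also have "frob_inner S W = frob_inner F (P - A)"
      unfolding PW S_def using frob_inner_mult_right[OF F cP cW] by simp
    also have "P * W = P - A" by (simp add: PW)
    finally have two: "2 * frob_inner F (P - A) = frob_inner (F * W) (P - A)" .
    have "F * W = (P - A) + (F - P) * W"
      unfolding PW using F cP cW by (simp add: minus_mult_distrib_mat[of F d r P W r])
        (intro eq_matI; auto)
    then have "frob_inner (F * W) (P - A) = N\<^sup>2 + frob_inner ((F - P) * W) (P - A)"
      using frob_inner_add_left[OF PA, of "(F - P) * W"] FP cW PA
      by (simp add: N_def frob_norm_power2[OF PA])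
    moreover have "\<bar>frob_inner ((F - P) * W) (P - A)\<bar> \<le> (1 - \<theta>) * N\<^sup>2"
    proof -
      have W: "0 \<le> frob_norm W" by (rule frob_norm_nonneg[OF cW])
      \<comment> \<open>As the Gram matrix of \<open>P\<close> is diagonal, the squared norm of
        \<open>P * W\<close> weights row \<open>i\<close> of \<open>W\<close> by the squared norm of
        column \<open>i\<close> of \<open>P\<close>, which is at least
        \<open>s\<^sup>2\<close>.\<close>
      have "(s * frob_norm W)\<^sup>2 = (\<Sum>i<r. \<Sum>j<r. s\<^sup>2 * (W $$ (i, j))\<^sup>2)"
        unfolding power_mult_distrib frob_norm_power2[OF cW] frob_inner_double_sum[OF cW cW]
        by (simp add: sum_distrib_left power2_eq_square)
      also have "\<dots> \<le> (\<Sum>i<r. \<Sum>j<r. p i * (W $$ (i, j))\<^sup>2)"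
        using sP by (intro sum_mono mult_right_mono) (auto simp: p_def)
      also have "\<dots> = frob_inner ((transpose_mat P * P) * W) W"
      proof -
        have cD: "transpose_mat P * P \<in> carrier_mat r r" using cP by simp
        have "((transpose_mat P * P) * W) $$ (i, j) = p i * W $$ (i, j)" if "i < r" "j < r" for i j
          unfolding p_def using that equiv_factorsD(3)[OF PE]
          by (intro diagonal_mult_left[OF cD cW that]) auto
        then show ?thesis
          using mult_carrier_mat[OF cD cW]
          by (simp add: frob_inner_double_sum[OF _ cW] power2_eq_square mult.assoc del: index_mult_mat)
      qed
      also have "(transpose_mat P * P) * W = transpose_mat P * (P * W)" using cP cW by simp
      also have "frob_inner \<dots> W = N\<^sup>2"
        using frob_inner_mult_right[of "P * W" d r P r W] cP cW
        by (simp add: N_def PW frob_norm_power2[of _ d r])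
      finally have sW: "s * frob_norm W \<le> N" using N by (rule power2_le_imp_le)
      have "\<bar>frob_inner ((F - P) * W) (P - A)\<bar> \<le> frob_norm ((F - P) * W) * N"
        unfolding N_def using FP cW PA by (intro abs_frob_inner_le) auto
      also have "\<dots> \<le> (frob_norm (F - P) * frob_norm W) * N"
        using frob_norm_mult_le[OF FP cW] N by (rule mult_right_mono)
      also have "\<dots> \<le> ((1 - \<theta>) * s * frob_norm W) * N"
        using near N W by (intro mult_right_mono) auto
      also have "\<dots> \<le> ((1 - \<theta>) * N) * N"
        using mult_left_mono[OF sW \<theta>] N by (intro mult_right_mono) (auto simp: mult.assoc)
      finally show ?thesis by (simp add: power2_eq_square mult.assoc)
    qed
    ultimately have "N\<^sup>2 - (1 - \<theta>) * N\<^sup>2 \<le> 2 * frob_inner F (P - A)" using two by linarith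
    then show ?thesis unfolding N_def[symmetric] by (simp add: algebra_simps)
  qed
qed

text \<open>The growth inequality at \<open>F\<close> tested with \<open>P'\<close> and the one at
  \<open>F'\<close> tested with \<open>P\<close> add up to
  \<open>\<theta> * N\<^sup>2 \<le> frob_inner (F - F') (P - P')\<close>; Cauchy-Schwarz and
  cancellation of \<open>N\<close> finish. The bound on the columns is assumed at one factor
  \<open>Fstar\<close> and carried over to \<open>P\<close> and \<open>P'\<close>.\<close>

lemma nearest_equiv_factor_lipschitz:
  assumes F: "F \<in> carrier_mat d r" and P: "P \<in> nearest_points (equiv_factors d r M) F"
    and F': "F' \<in> carrier_mat d r" and P': "P' \<in> nearest_points (equiv_factors d r M) F'"
    and Fstar: "Fstar \<in> equiv_factors d r M" and s: "0 < s"
    and sF: "\<And>i. i < r \<Longrightarrow> s\<^sup>2 \<le> (transpose_mat Fstar * Fstar) $$ (i, i)"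
    and near: "frob_norm (F - P) \<le> (1 - \<theta>) * s" "frob_norm (F' - P') \<le> (1 - \<theta>) * s"
  shows "\<theta> * frob_norm (P - P') \<le> frob_norm (F - F')"
proof -
  have PE: "P \<in> equiv_factors d r M" and PE': "P' \<in> equiv_factors d r M"
    using P P' by (auto simp: nearest_points_def)
  have cP: "P \<in> carrier_mat d r" and cP': "P' \<in> carrier_mat d r" using PE PE' by (auto dest: equiv_factorsD)
  have FF: "F - F' \<in> carrier_mat d r" and PP: "P - P' \<in> carrier_mat d r"
    using F' cP' by (auto intro: minus_carrier_mat)
  have s2: "0 < s\<^sup>2" using s by simp
  define N where "N = frob_norm (P - P')"
  have N: "N \<ge> 0" using frob_norm_nonneg[OF PP] by (simp add: N_def)
  have "\<theta> / 2 * N\<^sup>2 \<le> frob_inner F (P - P')"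
    unfolding N_def
    by (rule nearest_equiv_factor_growth[OF F P PE' s equiv_factors_gram_ge[OF Fstar PE s2 sF] near(1)])
  moreover have "\<theta> / 2 * N\<^sup>2 \<le> frob_inner F' (P' - P)"
    unfolding N_def frob_norm_minus_commute[OF cP cP']
    by (rule nearest_equiv_factor_growth[OF F' P' PE s equiv_factors_gram_ge[OF Fstar PE' s2 sF] near(2)])
  moreover have "frob_inner F' (P' - P) = - frob_inner F' (P - P')"
    by (simp add: frob_inner_diff_right[OF cP' cP F'] frob_inner_diff_right[OF cP cP' F'])
  moreover have "frob_inner (F - F') (P - P') = frob_inner F (P - P') - frob_inner F' (P - P')"
    by (rule frob_inner_diff_left[OF F F' PP])
  moreover have "frob_inner (F - F') (P - P') \<le> frob_norm (F - F') * N"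
    using abs_frob_inner_le[OF FF PP] by (simp add: N_def)
  ultimately have "(\<theta> * N) * N \<le> frob_norm (F - F') * N"
    by (simp add: power2_eq_square)
  then show ?thesis
    using N frob_norm_nonneg[OF FF] unfolding N_def[symmetric]
    by (cases "N = 0") (auto simp: mult_le_cancel_right)
qed

section \<open>The distance to the set of factors\<close>

lemma factor_dist_nearest:
  assumes F: "F \<in> carrier_mat d r" and P: "P \<in> nearest_points (equiv_factors d r M) F"
  shows "factor_dist d r M F = frob_norm (F - P)"
  unfolding factor_dist_def
proof (rule cInf_eq_minimum)
  show "frob_norm (F - P) \<in> (\<lambda>A. frob_norm (F - A)) ` equiv_factors d r M"
    using P by (auto simp: nearest_points_def)
  fix x assume "x \<in> (\<lambda>A. frob_norm (F - A)) ` equiv_factors d r M"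
  then obtain A where A: "A \<in> equiv_factors d r M" "x = frob_norm (F - A)" by auto
  then have "frob_norm (P - F) \<le> frob_norm (A - F)" using P by (simp add: nearest_points_def)
  then show "frob_norm (F - P) \<le> x"
    using A P F by (metis (no_types, lifting) equiv_factorsD(1) frob_norm_minus_commute
        mem_Collect_eq nearest_points_def)
qed

lemma factor_dist_le:
  assumes F: "F \<in> carrier_mat d r" and A: "A \<in> equiv_factors d r M"
  shows "factor_dist d r M F \<le> frob_norm (F - A)"
  unfolding factor_dist_def
proof (rule cINF_lower[OF _ A])
  show "bdd_below ((\<lambda>A. frob_norm (F - A)) ` equiv_factors d r M)"
    using equiv_factorsD(1) frob_norm_nonneg[OF minus_carrier_mat]
    by (intro bdd_belowI2[of _ 0]) blast
qed

subsection \<open>Singular values\<close>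

lemma proots_prod_linear_factors:
  fixes xs :: "'a :: idom list"
  shows "proots (\<Prod>x\<leftarrow>xs. [:- x, 1:]) = mset xs"
proof -
  have "(\<Prod>x\<leftarrow>xs. [:- x, 1:]) \<noteq> 0" by (auto simp: prod_list_zero_iff)
  then show ?thesis
  proof (induction xs)
    case (Cons x xs)
    then have "(\<Prod>x\<leftarrow>xs. [:- x, 1:]) \<noteq> 0" by auto
    then have "proots ([:- x, 1:] * (\<Prod>x\<leftarrow>xs. [:- x, 1:])) = {#x#} + mset xs"
      using Cons.IH by (subst proots_mult) auto
    then show ?case by simp
  qed simp
qed

text \<open>Orthogonal columns make the Gram matrix diagonal, in particular triangular, so its
  eigenvalues are its diagonal entries and the singular values are the column norms.\<close>

lemma singular_values_equiv_factor:
  assumes A: "A \<in> equiv_factors d r M"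
  shows "singular_values A = rev (sort (map sqrt (diag_mat (transpose_mat A * A))))"
proof -
  have G: "transpose_mat A * A \<in> carrier_mat r r" using equiv_factorsD(1)[OF A] by simp
  have "upper_triangular (transpose_mat A * A)"
    using equiv_factorsD(3)[OF A] G by (intro upper_triangularI) auto
  then have "proots (char_poly (transpose_mat A * A)) = mset (diag_mat (transpose_mat A * A))"
    by (simp add: char_poly_upper_triangular[OF G] proots_prod_linear_factors)
  then show ?thesis unfolding singular_values_def by (simp flip: mset_map)
qed

lemma
  assumes A: "A \<in> equiv_factors d r M" and r: "0 < r"
  shows sing_val_first_ge: "\<And>i. i < r \<Longrightarrow> sqrt ((transpose_mat A * A) $$ (i, i)) \<le> sing_val 1 A"
    and sing_val_last_le: "\<And>i. i < r \<Longrightarrow> sing_val r A \<le> sqrt ((transpose_mat A * A) $$ (i, i))"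
    and sing_val_last_nonneg: "0 \<le> sing_val r A"
proof -
  define xs where "xs = map sqrt (diag_mat (transpose_mat A * A))"
  have cA: "A \<in> carrier_mat d r" using A by (rule equiv_factorsD)
  have len: "length xs = r" using cA by (simp add: xs_def diag_mat_def)
  have nth: "xs ! i = sqrt ((transpose_mat A * A) $$ (i, i))" if "i < r" for i
    using that cA by (simp add: xs_def diag_mat_def)
  \<comment> \<open>The list is a reversed ascending sort, so the first singular value sits at index
    \<open>r - 1\<close> of the sorted list and the last one at index 0.\<close>
  have first: "sing_val 1 A = sort xs ! (r - 1)"
    using r len by (simp add: sing_val_def singular_values_equiv_factor[OF A] rev_nth flip: xs_def)
  have last: "sing_val r A = sort xs ! 0"
    using r len by (simp add: sing_val_def singular_values_equiv_factor[OF A] rev_nth flip: xs_def)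
  have pos: "\<exists>k<r. sort xs ! k = xs ! i" if "i < r" for i
    using that len by (metis in_set_conv_nth length_sort nth_mem set_sort)
  show "sqrt ((transpose_mat A * A) $$ (i, i)) \<le> sing_val 1 A" if i: "i < r" for i
  proof -
    obtain k where "k < r" "sort xs ! k = xs ! i" using pos[OF i] by blast
    then show ?thesis unfolding first nth[OF i, symmetric]
      using len sorted_nth_mono[OF sorted_sort, of k "r - 1" xs] by simp
  qed
  show "sing_val r A \<le> sqrt ((transpose_mat A * A) $$ (i, i))" if i: "i < r" for i
  proof -
    obtain k where "k < r" "sort xs ! k = xs ! i" using pos[OF i] by blast
    then show ?thesis unfolding last nth[OF i, symmetric]
      using len sorted_nth_mono[OF sorted_sort, of 0 k xs] by simp
  qed
  have "sort xs ! 0 \<in> set xs" using r len by (metis length_sort nth_mem set_sort)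
  then obtain i where i: "i < r" "sort xs ! 0 = xs ! i" using len by (auto simp: in_set_conv_nth)
  then have "sing_val r A = sqrt (col A i \<bullet> col A i)" using cA by (simp add: last nth)
  then show "0 \<le> sing_val r A" by (simp add: scalar_prod_def sum_nonneg)
qed

text \<open>Since the Gram matrix is diagonal, the squared norm of \<open>A *\<^sub>v v\<close> is a
  combination of the squared entries of \<open>v\<close> with the squared column norms as weights.
  This turns the Lipschitz condition into a bound on the step length in terms of singular
  values.\<close>

lemma spectral_norm_equiv_factor_le:
  assumes A: "A \<in> equiv_factors d r M" and r: "0 < r"
  shows "spectral_norm A \<le> sing_val 1 A"
  unfolding spectral_norm_def
proof (rule cSUP_least)
  have cA: "A \<in> carrier_mat d r" using A by (rule equiv_factorsD)
  have cAT: "transpose_mat A \<in> carrier_mat r d" using cA by simp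
  show "{v \<in> carrier_vec (dim_col A). v \<bullet> v \<le> (1 :: real)} \<noteq> {}"
  proof -
    have "(0\<^sub>v (dim_col A) :: real vec) \<bullet> 0\<^sub>v (dim_col A) = 0" by (simp add: scalar_prod_def)
    then have "0\<^sub>v (dim_col A) \<in> {v \<in> carrier_vec (dim_col A). v \<bullet> v \<le> (1 :: real)}" by simp
    then show ?thesis by blast
  qed
  fix v assume "v \<in> {v \<in> carrier_vec (dim_col A). v \<bullet> v \<le> (1 :: real)}"
  then have v: "v \<in> carrier_vec r" and vv: "v \<bullet> v \<le> 1" using cA by auto
  define G where "G = transpose_mat A * A"
  define \<sigma> where "\<sigma> = sing_val 1 A"
  have G: "G \<in> carrier_mat r r" using cA by (simp add: G_def)
  have Gi: "0 \<le> G $$ (i, i)" "sqrt (G $$ (i, i)) \<le> \<sigma>" if "i < r" for i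
    using that cA sing_val_first_ge[OF A r that] by (auto simp: G_def \<sigma>_def scalar_prod_def sum_nonneg)
  have \<sigma>: "0 \<le> \<sigma>" using Gi[OF r] real_sqrt_ge_zero order_trans by blast
  have "(A *\<^sub>v v) \<bullet> (A *\<^sub>v v) = (transpose_mat A *\<^sub>v (A *\<^sub>v v)) \<bullet> v"
    using transpose_vec_mult_scalar[OF cA v, of "A *\<^sub>v v"] cA v by simp
  also have "transpose_mat A *\<^sub>v (A *\<^sub>v v) = G *\<^sub>v v"
    unfolding G_def using assoc_mult_mat_vec[OF cAT cA v] by simp
  also have "(G *\<^sub>v v) \<bullet> v = (\<Sum>i<r. G $$ (i, i) * (v $ i)\<^sup>2)"
  proof -
    have "(G *\<^sub>v v) $ i = G $$ (i, i) * v $ i" if i: "i < r" for i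
    proof -
      have "(G *\<^sub>v v) $ i = (\<Sum>k<r. G $$ (i, k) * v $ k)"
        using i G v by (simp add: scalar_prod_def atLeast0LessThan)
      also have "\<dots> = (\<Sum>k<r. if k = i then G $$ (i, i) * v $ i else 0)"
        using equiv_factorsD(3)[OF A i] by (intro sum.cong) (auto simp: G_def)
      finally show ?thesis using i by simp
    qed
    then show ?thesis
      using v by (simp add: scalar_prod_def atLeast0LessThan power2_eq_square mult.assoc)
  qed
  also have "\<dots> \<le> (\<Sum>i<r. \<sigma>\<^sup>2 * (v $ i)\<^sup>2)"
  proof (intro sum_mono mult_right_mono)
    fix i assume "i \<in> {..<r}"
    then have i: "i < r" by simp
    show "G $$ (i, i) \<le> \<sigma>\<^sup>2" using power_mono[OF Gi(2)[OF i], of 2] Gi(1)[OF i] by simp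
  qed simp
  also have "\<dots> = \<sigma>\<^sup>2 * (v \<bullet> v)"
    using v by (simp add: scalar_prod_def atLeast0LessThan power2_eq_square sum_distrib_left)
  also have "\<dots> \<le> \<sigma>\<^sup>2" using mult_left_mono[OF vv, of "\<sigma>\<^sup>2"] by simp
  finally show "sqrt ((A *\<^sub>v v) \<bullet> (A *\<^sub>v v)) \<le> sing_val 1 A"
    using \<sigma> by (metis \<sigma>_def real_sqrt_le_iff real_sqrt_abs abs_of_nonneg)
qed

subsection \<open>Contraction\<close>

text \<open>The scalar core of one step: \<open>D, D'\<close> are the distances before and after it, \<open>x\<close> the distance
  of the new iterate to the old nearest factor, \<open>\<delta>\<close> the step length, \<open>w\<close> the displacement of the
  nearest factor and \<open>g\<close> the inner product with the gradient.\<close>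

lemma contraction_arith:
  fixes D D' x \<delta> w \<epsilon> \<alpha> \<beta> c \<theta> K g \<eta> :: real
  assumes nonneg: "0 \<le> D" "0 \<le> D'" "0 \<le> \<delta>" "0 \<le> w" "0 \<le> \<epsilon>"
    and ab: "0 < \<alpha>" "\<alpha> \<le> \<beta>" and K: "1 \<le> K" and \<theta>: "0 < \<theta>" "\<theta> < 1"
    and c: "0 < c" "c \<le> 1 / 8" "c \<le> \<theta>\<^sup>2 / 8" and \<eta>: "\<eta> = c * (\<alpha> / (K * \<beta>\<^sup>2))"
    and x: "D' \<le> x" "x \<le> D' + w" and w: "\<theta> * w \<le> \<delta>"
    and step: "x\<^sup>2 \<le> D\<^sup>2 - \<delta>\<^sup>2 - 2 * \<eta> * g"
    and g: "\<alpha> * D'\<^sup>2 - \<beta>\<^sup>2 / \<alpha> * w\<^sup>2 - \<alpha> * \<epsilon>\<^sup>2 - (\<beta> * \<delta> + \<alpha> * \<epsilon>) * x \<le> g"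
  shows "D'\<^sup>2 \<le> (1 - c * (\<alpha>\<^sup>2 / (K * \<beta>\<^sup>2))) * D\<^sup>2 + 16 * (c * (\<alpha>\<^sup>2 / (K * \<beta>\<^sup>2))) * \<epsilon>\<^sup>2"
proof -
  have \<beta>: "0 < \<beta>" using ab by linarith
  have K0: "0 < K" using K by linarith
  \<comment> \<open>\<open>q\<close> is the contraction rate, equal to
    \<open>\<eta> * \<alpha>\<close>, and \<open>b\<close> is the step size times the smoothness
    constant; both are at most \<open>c\<close>.\<close>
  define q where "q = c * (\<alpha>\<^sup>2 / (K * \<beta>\<^sup>2))"
  define b where "b = \<eta> * \<beta>"
  have \<eta>0: "0 < \<eta>" using c ab \<beta> K0 by (simp add: \<eta>)
  have q\<eta>: "\<eta> * \<alpha> = q" by (simp add: \<eta> q_def power2_eq_square)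
  have ratio: "\<alpha> / \<beta> \<le> 1" "0 \<le> \<alpha> / \<beta>" and cK: "c / K \<le> c" "0 \<le> c / K"
    using ab \<beta> c K by (auto simp: field_simps mult_left_le)
  have q_eq: "q = c / K * (\<alpha> / \<beta>)\<^sup>2" by (simp add: q_def power_divide)
  have b_eq: "b = c / K * (\<alpha> / \<beta>)" using \<beta> by (simp add: b_def \<eta> power2_eq_square)
  have q0: "0 \<le> q" using c K0 by (simp add: q_def)
  have "(\<alpha> / \<beta>)\<^sup>2 \<le> 1" using ratio by (simp add: power_le_one)
  then have qc: "q \<le> c" unfolding q_eq using mult_left_le[OF _ cK(2)] cK(1) by (meson order_trans)
  have b0: "0 \<le> b" unfolding b_eq using ratio(2) cK(2) by (rule mult_nonneg_nonneg[rotated])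
  have bc: "b \<le> c" unfolding b_eq using mult_left_le[OF ratio(1) cK(2)] cK(1) by linarith
  \<comment> \<open>This relation lets the mixed term in \<delta> and \<open>D'\<close> be split by
    AM-GM between the squared step length and the gain \<open>q * D'\<^sup>2\<close>.\<close>
  have "b\<^sup>2 = q * (c / K)" by (simp add: q_eq b_eq power2_eq_square mult_ac)
  also have "\<dots> \<le> q * (1 / 8)" using q0 order_trans[OF cK(1) c(2)] by (intro mult_left_mono)
  finally have b2: "b\<^sup>2 \<le> q / 8" by simp
  have "\<eta> * (\<beta>\<^sup>2 / \<alpha>) = c / K" using ab \<beta> by (simp add: \<eta> power2_eq_square)
  then have hb: "\<eta> * (\<beta>\<^sup>2 / \<alpha>) \<le> c" using cK by simp
  have "(\<theta> * w)\<^sup>2 \<le> \<delta>\<^sup>2" using w \<theta> nonneg by (intro power_mono) auto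
  then have w2: "\<theta>\<^sup>2 * w\<^sup>2 \<le> \<delta>\<^sup>2" by (simp add: power_mult_distrib)
  have cw: "c * w\<^sup>2 \<le> \<delta>\<^sup>2 / 8"
    using mult_right_mono[OF c(3), of "w\<^sup>2"] w2 by simp
  have "\<theta>\<^sup>2 \<le> \<theta>" using \<theta> by (simp add: power2_eq_square mult_left_le)
  then have c\<theta>: "c \<le> \<theta> / 8" using c(3) by linarith
  have bw: "b * (\<delta> * w) \<le> \<delta>\<^sup>2 / 8"
  proof -
    have "b * (\<delta> * w) \<le> \<theta> / 8 * (\<delta> * w)"
      using bc c\<theta> nonneg by (intro mult_right_mono) auto
    also have "\<dots> = \<delta> * (\<theta> * w) / 8" by simp
    also have "\<dots> \<le> \<delta> * \<delta> / 8" using w nonneg by (intro divide_right_mono mult_left_mono) auto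
    finally show ?thesis by (simp add: power2_eq_square)
  qed
  have bD: "2 * b * \<delta> * D' \<le> \<delta>\<^sup>2 / 4 + q / 2 * D'\<^sup>2"
  proof -
    have "0 \<le> (\<delta> / 2 - 2 * b * D')\<^sup>2" by simp
    then have "2 * b * \<delta> * D' \<le> \<delta>\<^sup>2 / 4 + 4 * b\<^sup>2 * D'\<^sup>2"
      by (simp add: power2_eq_square algebra_simps)
    also have "4 * b\<^sup>2 * D'\<^sup>2 \<le> q / 2 * D'\<^sup>2" using b2 by (intro mult_right_mono) auto
    finally show ?thesis by simp
  qed
  have "0 \<le> (D' / 2 - 2 * \<epsilon>)\<^sup>2" by simp
  then have "2 * \<epsilon> * D' \<le> D'\<^sup>2 / 4 + 4 * \<epsilon>\<^sup>2" by (simp add: power2_eq_square algebra_simps)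
  then have eD: "q * (2 * \<epsilon> * D') \<le> q * (D'\<^sup>2 / 4 + 4 * \<epsilon>\<^sup>2)" using q0 by (rule mult_left_mono)
  have "0 \<le> (w - \<epsilon>)\<^sup>2" by simp
  then have "2 * \<epsilon> * w \<le> \<epsilon>\<^sup>2 + w\<^sup>2" by (simp add: power2_eq_square algebra_simps)
  then have "q * (2 * \<epsilon> * w) \<le> q * (\<epsilon>\<^sup>2 + w\<^sup>2)" using q0 by (rule mult_left_mono)
  also have "\<dots> \<le> q * \<epsilon>\<^sup>2 + c * w\<^sup>2" using mult_right_mono[OF qc, of "w\<^sup>2"] by (simp add: distrib_left)
  finally have ew: "q * (2 * \<epsilon> * w) \<le> q * \<epsilon>\<^sup>2 + \<delta>\<^sup>2 / 8" using cw by linarith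
  have "2 * (\<eta> * (\<beta>\<^sup>2 / \<alpha>)) * w\<^sup>2 \<le> 2 * (c * w\<^sup>2)"
    using mult_right_mono[OF hb, of "w\<^sup>2"] by simp
  then have hw: "2 * (\<eta> * (\<beta>\<^sup>2 / \<alpha>)) * w\<^sup>2 \<le> \<delta>\<^sup>2 / 4" using cw by linarith
  have "(b * \<delta> + q * \<epsilon>) * x \<le> (b * \<delta> + q * \<epsilon>) * (D' + w)"
    using x(2) b0 q0 nonneg by (intro mult_left_mono) auto
  then have hx: "2 * ((b * \<delta> + q * \<epsilon>) * x)
      \<le> 2 * b * \<delta> * D' + 2 * (b * (\<delta> * w)) + q * (2 * \<epsilon> * D') + q * (2 * \<epsilon> * w)"
    by (simp add: algebra_simps)
  have "2 * \<eta> * (\<alpha> * D'\<^sup>2 - \<beta>\<^sup>2 / \<alpha> * w\<^sup>2 - \<alpha> * \<epsilon>\<^sup>2 - (\<beta> * \<delta> + \<alpha> * \<epsilon>) * x) \<le> 2 * \<eta> * g"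
    using g \<eta>0 by (intro mult_left_mono) auto
  moreover have "2 * \<eta> * (\<alpha> * D'\<^sup>2 - \<beta>\<^sup>2 / \<alpha> * w\<^sup>2 - \<alpha> * \<epsilon>\<^sup>2 - (\<beta> * \<delta> + \<alpha> * \<epsilon>) * x)
      = 2 * (\<eta> * \<alpha>) * D'\<^sup>2 - 2 * (\<eta> * (\<beta>\<^sup>2 / \<alpha>)) * w\<^sup>2 - 2 * (\<eta> * \<alpha>) * \<epsilon>\<^sup>2
        - 2 * ((\<eta> * \<beta> * \<delta> + \<eta> * \<alpha> * \<epsilon>) * x)"
    by (simp add: algebra_simps)
  ultimately have "x\<^sup>2 \<le> D\<^sup>2 - \<delta>\<^sup>2 - (2 * q * D'\<^sup>2 - 2 * (\<eta> * (\<beta>\<^sup>2 / \<alpha>)) * w\<^sup>2 - 2 * q * \<epsilon>\<^sup>2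
        - 2 * ((b * \<delta> + q * \<epsilon>) * x))"
    using step unfolding q\<eta> b_def[symmetric] by linarith
  moreover have "D'\<^sup>2 \<le> x\<^sup>2" using x nonneg by (intro power_mono) auto
  moreover have "0 \<le> \<delta>\<^sup>2" by simp
  moreover have "q * (D'\<^sup>2 / 4 + 4 * \<epsilon>\<^sup>2) = q * D'\<^sup>2 / 4 + 4 * (q * \<epsilon>\<^sup>2)" by (simp add: algebra_simps)
  moreover have "q / 2 * D'\<^sup>2 = q * D'\<^sup>2 / 2" "2 * q * D'\<^sup>2 = 2 * (q * D'\<^sup>2)" "2 * q * \<epsilon>\<^sup>2 = 2 * (q * \<epsilon>\<^sup>2)"
    by simp_all
  \<comment> \<open>The budget: the four bounds containing \<open>\<delta>\<^sup>2\<close> use 1/4 +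
    1/4 + 1/4 + 1/8 of it, which is less than the available 1. Of the gain
    \<open>2 * (q * D'\<^sup>2)\<close> the mixed terms take 1/2 and 1/4, which leaves 5/4. The
    noise terms add up to 2 + 4 + 1 = 7.\<close>
  ultimately have main: "D'\<^sup>2 + 5 / 4 * (q * D'\<^sup>2) \<le> D\<^sup>2 + 7 * (q * \<epsilon>\<^sup>2)"
    using hw bw bD eD ew hx by linarith
  have q8: "q \<le> 1 / 8" using qc c(2) by linarith
  \<comment> \<open>The surplus of 5/4 over 1 replaces division by \<open>1 + 5 / 4 * q\<close> by
    multiplication with \<open>1 - q\<close>; this is valid because \<open>q\<close> is at most
    1/8.\<close>
  have "D'\<^sup>2 \<le> D'\<^sup>2 * ((1 + 5 / 4 * q) * (1 - q))"
  proof -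
    have "q * q \<le> q * (1 / 8)" using q8 q0 by (rule mult_left_mono)
    then have "1 \<le> (1 + 5 / 4 * q) * (1 - q)" using q0 by (simp add: algebra_simps)
    then show ?thesis using mult_left_mono[of 1 _ "D'\<^sup>2"] by simp
  qed
  also have "\<dots> = (1 - q) * (D'\<^sup>2 + 5 / 4 * (q * D'\<^sup>2))" by (simp add: algebra_simps)
  also have "\<dots> \<le> (1 - q) * (D\<^sup>2 + 7 * (q * \<epsilon>\<^sup>2))" using main q8 by (intro mult_left_mono) auto
  also have "\<dots> \<le> (1 - q) * D\<^sup>2 + 7 * (q * \<epsilon>\<^sup>2)" using q0 by (simp add: algebra_simps)
  also have "\<dots> \<le> (1 - q) * D\<^sup>2 + 16 * q * \<epsilon>\<^sup>2" using q0 by simp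
  finally show ?thesis unfolding q_def .
qed

text \<open>The new iterate is compared with the old nearest factor \<open>P\<close>, which is
  feasible by faithfulness. The step is so short that both iterates lie in the ball of radius
  \<rho>, where all conditions apply, and the matrix inequalities then reduce to the scalar lemma
  with \<open>\<theta> = \<tau>\<^sup>2\<close>.\<close>

lemma projected_gradient_contraction:
  fixes \<tau> :: real
  defines "c \<equiv> \<tau> ^ 4 * (1 - \<tau>) / 8"
  assumes \<tau>: "0 < \<tau>" "\<tau> < 1" and r: "0 < r" and Fstar: "Fstar \<in> equiv_factors d r M"
    and s: "0 < sing_val r Fstar" and \<kappa>: "\<kappa> = sing_val 1 Fstar / sing_val r Fstar"
    and grad: "\<And>X. X \<in> carrier_mat d r \<Longrightarrow> gradient d r f X \<in> carrier_mat d r"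
    and S: "S \<subseteq> carrier_mat d r" "convex_mats S"
    and ab: "0 < \<alpha>" "\<alpha> \<le> \<beta>" and \<epsilon>: "0 \<le> \<epsilon>"
    and \<rho>: "\<rho> = (1 - \<tau>\<^sup>2) * sing_val r Fstar"
    and faithful: "faithful d r M S \<rho>" and descent: "local_descent d r M f S \<alpha> \<beta> \<epsilon> \<rho>"
    and lip: "local_lipschitz d r M Fstar f S \<beta> \<rho>" and smooth: "local_smooth d r M f S \<alpha> \<beta> \<epsilon> \<rho>"
    and \<eta>: "\<eta> = c * (\<alpha> / (\<kappa> ^ 6 * \<beta>\<^sup>2))"
    and X: "X \<in> S" "factor_dist d r M X \<le> (1 - \<tau>) * sing_val r Fstar"
    and X': "X' \<in> nearest_points S (X - \<eta> \<cdot>\<^sub>m gradient d r f X)"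
  shows "(factor_dist d r M X')\<^sup>2 \<le> (1 - c * (\<alpha>\<^sup>2 / (\<kappa> ^ 6 * \<beta>\<^sup>2))) * (factor_dist d r M X)\<^sup>2
    + 16 * (c * (\<alpha>\<^sup>2 / (\<kappa> ^ 6 * \<beta>\<^sup>2))) * \<epsilon>\<^sup>2"
proof -
  define \<sigma> where "\<sigma> = sing_val r Fstar"
  have \<sigma>: "0 < \<sigma>" using s by (simp add: \<sigma>_def)
  have \<beta>: "0 < \<beta>" using ab by linarith
  have \<tau>4: "\<tau> ^ 4 \<le> \<tau>" "\<tau> ^ 4 \<le> 1" "0 < \<tau> ^ 4"
  proof -
    show "\<tau> ^ 4 \<le> \<tau>" using \<tau> power_decreasing[of 1 4 \<tau>] by simp
    show "\<tau> ^ 4 \<le> 1" using \<tau> by (intro power_le_one) auto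
    show "0 < \<tau> ^ 4" using \<tau>(1) by (rule zero_less_power)
  qed
  have c: "0 < c" using \<tau> by (simp add: c_def)
  \<comment> \<open>The shape of \<open>c\<close>: the fourth power is the square of the inverse
    Lipschitz constant \<open>\<tau>\<^sup>2\<close> of the nearest factor, 1/8 serves to absorb the
    cross terms, and \<open>1 - \<tau>\<close> lets one step fit between the two radii.\<close>
  have "c \<le> \<tau> ^ 4 / 8" 
    unfolding c_def using \<tau> \<tau>4(3) mult_left_le[of "1 - \<tau>" "\<tau> ^ 4"] by linarith
  then have c8: "c \<le> 1 / 8" "c \<le> (\<tau>\<^sup>2)\<^sup>2 / 8" using \<tau>4 by (auto simp flip: power_mult)
  have "\<tau> ^ 4 * (1 - \<tau>) \<le> \<tau> * (1 - \<tau>)" using \<tau> \<tau>4 by (intro mult_right_mono) auto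
  moreover have "0 \<le> \<tau> * (1 - \<tau>)" using \<tau> by simp
  ultimately have c\<tau>: "c \<le> \<tau> * (1 - \<tau>)" unfolding c_def by linarith
  have "\<sigma> \<le> sing_val 1 Fstar"
    using sing_val_last_le[OF Fstar r r] sing_val_first_ge[OF Fstar r r] by (simp add: \<sigma>_def)
  then have \<kappa>1: "1 \<le> \<kappa>" unfolding \<kappa> \<sigma>_def[symmetric] using \<sigma> by simp
  have K1: "1 \<le> \<kappa> ^ 6" using \<kappa>1 by (rule one_le_power)
  have \<kappa>K: "\<kappa> \<le> \<kappa> ^ 6" using power_increasing[of 1 6 \<kappa>] \<kappa>1 by simp
  have \<eta>0: "0 \<le> \<eta>" using c ab K1 by (simp add: \<eta>)
  have "\<tau>\<^sup>2 \<le> \<tau>" using \<tau> by (simp add: power2_eq_square mult_left_le)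
  then have "(1 - \<tau>) * \<sigma> \<le> (1 - \<tau>\<^sup>2) * \<sigma>" using \<sigma> by (intro mult_right_mono) auto
  then have X\<rho>: "factor_dist d r M X \<le> \<rho>" using X(2) unfolding \<rho> \<sigma>_def by linarith
  have cX: "X \<in> carrier_mat d r" using X(1) S by auto
  have XB: "X \<in> S \<inter> factor_ball d r M \<rho>" using X(1) cX X\<rho> by (simp add: factor_ball_def)
  \<comment> \<open>The descent condition at \<open>X\<close> supplies a nearest factor, so no
    compactness argument is made.\<close>
  obtain P where P: "P \<in> nearest_points (equiv_factors d r M) X"
    using descent XB unfolding local_descent_def by blast
  have PS: "P \<in> S" using faithful XB P unfolding faithful_def by blast
  have PE: "P \<in> equiv_factors d r M" using P by (simp add: nearest_points_def)
  have cP: "P \<in> carrier_mat d r" using PE by (rule equiv_factorsD)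
  define G where "G = gradient d r f X"
  have cG: "G \<in> carrier_mat d r" using grad[OF cX] by (simp add: G_def)
  have X'S: "X' \<in> S" using X' by (simp add: nearest_points_def)
  then have cX': "X' \<in> carrier_mat d r" using S by auto
  define D where "D = frob_norm (X - P)"
  have D: "factor_dist d r M X = D" unfolding D_def by (rule factor_dist_nearest[OF cX P])
  have "frob_norm (X' - X) \<le> \<eta> * frob_norm G"
    using projected_step_length[OF S X(1) cG _ \<eta>0] X' by (simp add: G_def)
  also have "frob_norm G \<le> \<beta> * spectral_norm Fstar"
    using lip XB by (simp add: local_lipschitz_def G_def)
  also have "spectral_norm Fstar \<le> \<kappa> * \<sigma>"
    using spectral_norm_equiv_factor_le[OF Fstar r] \<sigma> by (simp add: \<kappa> \<sigma>_def)
  \<comment> \<open>The step size cancels the Lipschitz constant, and the remaining ratios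
    \<alpha>/\<beta> and \<open>\<kappa> / \<kappa> ^ 6\<close> are at most 1.\<close>
  also have "\<eta> * (\<beta> * (\<kappa> * \<sigma>)) = c * ((\<alpha> / \<beta>) * (\<kappa> / \<kappa> ^ 6)) * \<sigma>"
    using \<beta> by (simp add: \<eta> power2_eq_square mult_ac)
  also have "\<dots> \<le> c * (1 * 1) * \<sigma>"
    using ab \<beta> \<kappa>1 \<kappa>K K1 c \<sigma> by (intro mult_right_mono mult_left_mono mult_mono) (auto simp: divide_le_eq_1)
  finally have len: "frob_norm (X' - X) \<le> c * \<sigma>" using \<eta>0 \<beta> by (simp add: mult_left_mono)
  have "frob_norm (X' - P) \<le> frob_norm (X' - X) + frob_norm (X - P)"
    by (rule frob_norm_triangle[OF cX' cX cP])
  also have "\<dots> \<le> c * \<sigma> + (1 - \<tau>) * \<sigma>" using len X(2) D by (simp add: \<sigma>_def D_def)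
  \<comment> \<open>\<open>\<tau> * (1 - \<tau>) * \<sigma>\<close> is exactly the gap between the
    radius \<open>(1 - \<tau>) * \<sigma>\<close> and \<rho>.\<close>
  also have "\<dots> \<le> \<tau> * (1 - \<tau>) * \<sigma> + (1 - \<tau>) * \<sigma>" using c\<tau> \<sigma> by (simp add: mult_right_mono)
  also have "\<dots> = \<rho>" by (simp add: \<rho> \<sigma>_def power2_eq_square algebra_simps)
  finally have X'P: "frob_norm (X' - P) \<le> \<rho>" .
  then have "factor_dist d r M X' \<le> \<rho>" using factor_dist_le[OF cX' PE] by linarith
  then have X'B: "X' \<in> S \<inter> factor_ball d r M \<rho>" using X'S cX' by (simp add: factor_ball_def)
  define G' where "G' = gradient d r f X'"
  have cG': "G' \<in> carrier_mat d r" using grad[OF cX'] by (simp add: G'_def)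
  \<comment> \<open>Descent is used at the new iterate but tested against the old factor
    \<open>P\<close>; the price is the term in \<open>frob_norm (P' - P)\<close>.\<close>
  obtain P' where P': "P' \<in> nearest_points (equiv_factors d r M) X'"
    and desc: "\<alpha> * (frob_norm (X' - P'))\<^sup>2 - \<beta>\<^sup>2 / \<alpha> * (frob_norm (P' - P))\<^sup>2 - \<alpha> * \<epsilon>\<^sup>2
      \<le> frob_inner G' (X' - P)"
    using descent X'B PE unfolding local_descent_def G'_def by blast
  have PE': "P' \<in> equiv_factors d r M" using P' by (simp add: nearest_points_def)
  have cP': "P' \<in> carrier_mat d r" using PE' by (rule equiv_factorsD)
  have D': "factor_dist d r M X' = frob_norm (X' - P')" by (rule factor_dist_nearest[OF cX' P'])
  have c1: "X' - P \<in> carrier_mat d r" using cP by (rule minus_carrier_mat)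
  \<comment> \<open>Smoothness exchanges the gradient at the new iterate for the one at
    \<open>X\<close>, which is the one that drives the step.\<close>
  have "\<bar>frob_inner (G' - G) (X' - P)\<bar> \<le> (\<beta> * frob_norm (X' - X) + \<alpha> * \<epsilon>) * frob_norm (X' - P)"
    using smooth X'B XB PE unfolding local_smooth_def G_def G'_def by blast
  then have g: "\<alpha> * (frob_norm (X' - P'))\<^sup>2 - \<beta>\<^sup>2 / \<alpha> * (frob_norm (P' - P))\<^sup>2 - \<alpha> * \<epsilon>\<^sup>2
      - (\<beta> * frob_norm (X' - X) + \<alpha> * \<epsilon>) * frob_norm (X' - P) \<le> frob_inner G (X' - P)"
    using desc frob_inner_diff_left[OF cG' cG c1] by linarith
  have gram: "\<sigma>\<^sup>2 \<le> (transpose_mat Fstar * Fstar) $$ (i, i)" if "i < r" for i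
    using sing_val_last_le[OF Fstar r that] \<sigma> real_le_rsqrt sqrt_le_D
    by (simp add: \<sigma>_def real_le_lsqrt sqrt_ge_absD)
  have w: "\<tau>\<^sup>2 * frob_norm (P' - P) \<le> frob_norm (X' - X)"
  proof (rule nearest_equiv_factor_lipschitz[OF cX' P' cX P Fstar \<sigma> gram])
    show "frob_norm (X' - P') \<le> (1 - \<tau>\<^sup>2) * \<sigma>"
      using \<open>factor_dist d r M X' \<le> \<rho>\<close> D' by (simp add: \<rho> \<sigma>_def)
    show "frob_norm (X - P) \<le> (1 - \<tau>\<^sup>2) * \<sigma>" using X\<rho> D by (simp add: \<rho> \<sigma>_def D_def)
  qed
  show ?thesis unfolding D D'
  proof (rule contraction_arith[OF _ _ _ _ \<epsilon> ab K1 _ _ c c8 \<eta> _ _ w _ g])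
    show "0 \<le> D" unfolding D_def by (rule frob_norm_nonneg[OF minus_carrier_mat[OF cP]])
    show "0 \<le> frob_norm (X' - P')" by (rule frob_norm_nonneg[OF minus_carrier_mat[OF cP']])
    show "0 \<le> frob_norm (X' - X)" by (rule frob_norm_nonneg[OF minus_carrier_mat[OF cX]])
    show "0 \<le> frob_norm (P' - P)" by (rule frob_norm_nonneg[OF minus_carrier_mat[OF cP]])
    show "0 < \<tau>\<^sup>2" "\<tau>\<^sup>2 < 1" using \<tau> by (auto simp: power_less_one_iff)
    show "frob_norm (X' - P') \<le> frob_norm (X' - P)"
      using factor_dist_le[OF cX' PE] D' by simp
    show "frob_norm (X' - P) \<le> frob_norm (X' - P') + frob_norm (P' - P)"
      by (rule frob_norm_triangle[OF cX' cP' cP])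
    show "(frob_norm (X' - P))\<^sup>2 \<le> D\<^sup>2 - (frob_norm (X' - X))\<^sup>2 - 2 * \<eta> * frob_inner G (X' - P)"
      unfolding D_def using projected_step[OF S X(1) cG _ PS] X' by (simp add: G_def)
  qed
qed

section \<open>Iterating the one-step contraction\<close>

theorem theorem2:
  fixes \<tau> :: real
  assumes "0 < \<tau>" "\<tau> < 1"
  shows "\<exists>c::real. 0 < c \<and> c < 1 \<and>
    (\<forall>(d::nat) (r::nat) (M::real mat) (Fstar::real mat) (loss::real mat \<Rightarrow> real) (S::real mat set)
      (\<alpha>::real) (\<beta>::real) (L::real) (\<epsilon>::real) (\<rho>::real) (\<kappa>::real) (\<eta>::real)
      (f::real mat \<Rightarrow> real) (Fs::nat \<Rightarrow> real mat).
        0 < r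
      \<and> M \<in> carrier_mat d d \<and> psd_mat d M \<and> vec_space.rank d M = r
      \<and> Fstar \<in> equiv_factors d r M
      \<and> \<kappa> = sing_val 1 Fstar / sing_val r Fstar
      \<and> (\<forall>X\<in>sym_mats d. \<exists>G. has_gradient_on (sym_mats d) loss G X)
      \<and> f = (\<lambda>F. loss (F * transpose_mat F))
      \<and> S \<subseteq> carrier_mat d r \<and> convex_mats S \<and> proj_well_defined d r S
      \<and> 0 < \<alpha> \<and> \<alpha> \<le> \<beta> \<and> \<beta> = L
      \<and> 0 \<le> \<epsilon> \<and> \<epsilon> \<le> (1 - \<tau>) / 4 * sing_val r Fstar
      \<and> \<rho> = (1 - \<tau>\<^sup>2) * sing_val r Fstar
      \<and> faithful d r M S \<rho>
      \<and> local_descent d r M f S \<alpha> \<beta> \<epsilon> \<rho>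
      \<and> local_lipschitz d r M Fstar f S L \<rho>
      \<and> local_smooth d r M f S \<alpha> \<beta> \<epsilon> \<rho>
      \<and> \<eta> = c * (\<alpha> / (\<kappa> ^ 6 * \<beta>\<^sup>2))
      \<and> Fs 0 \<in> S \<inter> factor_ball d r M ((1 - \<tau>) * sing_val r Fstar)
      \<and> (\<forall>t. Fs (Suc t) = proj_onto S (Fs t - \<eta> \<cdot>\<^sub>m gradient d r f (Fs t)))
      \<longrightarrow> (\<forall>t\<ge>1. (factor_dist d r M (Fs t))\<^sup>2
              \<le> (1 - c * (\<alpha>\<^sup>2 / (\<kappa> ^ 6 * \<beta>\<^sup>2))) ^ t * (factor_dist d r M (Fs 0))\<^sup>2 + 16 * \<epsilon>\<^sup>2))"
proof (intro exI[of _ "\<tau> ^ 4 * (1 - \<tau>) / 8"] conjI allI impI; (elim conjE)?)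
  define c where "c = \<tau> ^ 4 * (1 - \<tau>) / 8"
  show c0: "0 < \<tau> ^ 4 * (1 - \<tau>) / 8" using assms by simp
  have "\<tau> ^ 4 * (1 - \<tau>) \<le> 1 * 1" using assms by (intro mult_mono power_le_one) auto
  then show c1: "\<tau> ^ 4 * (1 - \<tau>) / 8 < 1" by simp
  fix d r :: nat and M Fstar :: "real mat" and loss :: "real mat \<Rightarrow> real" and S :: "real mat set"
    and \<alpha> \<beta> L \<epsilon> \<rho> \<kappa> \<eta> :: real and f :: "real mat \<Rightarrow> real" and Fs :: "nat \<Rightarrow> real mat" and t :: nat
  assume r: "0 < r" and Fstar: "Fstar \<in> equiv_factors d r M"
    and \<kappa>: "\<kappa> = sing_val 1 Fstar / sing_val r Fstar"
    and loss: "\<forall>X\<in>sym_mats d. \<exists>G. has_gradient_on (sym_mats d) loss G X"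
    and f: "f = (\<lambda>F. loss (F * transpose_mat F))"
    and S: "S \<subseteq> carrier_mat d r" "convex_mats S" and proj: "proj_well_defined d r S"
    and ab: "0 < \<alpha>" "\<alpha> \<le> \<beta>" and L: "\<beta> = L"
    and \<epsilon>: "0 \<le> \<epsilon>" "\<epsilon> \<le> (1 - \<tau>) / 4 * sing_val r Fstar"
    and \<rho>: "\<rho> = (1 - \<tau>\<^sup>2) * sing_val r Fstar"
    and conds: "faithful d r M S \<rho>" "local_descent d r M f S \<alpha> \<beta> \<epsilon> \<rho>"
      "local_lipschitz d r M Fstar f S L \<rho>" "local_smooth d r M f S \<alpha> \<beta> \<epsilon> \<rho>"
    and \<eta>: "\<eta> = \<tau> ^ 4 * (1 - \<tau>) / 8 * (\<alpha> / (\<kappa> ^ 6 * \<beta>\<^sup>2))"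
    and F0: "Fs 0 \<in> S \<inter> factor_ball d r M ((1 - \<tau>) * sing_val r Fstar)"
    and Fs: "\<forall>t. Fs (Suc t) = proj_onto S (Fs t - \<eta> \<cdot>\<^sub>m gradient d r f (Fs t))"
  have grad: "gradient d r f X \<in> carrier_mat d r" if "X \<in> carrier_mat d r" for X
    unfolding f using loss that by (rule gradient_gram_carrier)
  have nearest: "Fs (Suc t) \<in> nearest_points S (Fs t - \<eta> \<cdot>\<^sub>m gradient d r f (Fs t))" if "Fs t \<in> S" for t
  proof -
    have "Fs t \<in> carrier_mat d r" using that S by auto
    then have "Fs t - \<eta> \<cdot>\<^sub>m gradient d r f (Fs t) \<in> carrier_mat d r"
      using grad by (intro minus_carrier_mat) simp
    then show ?thesis using Fs proj_onto_nearest[OF proj] by simp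
  qed
  define q where "q = c * (\<alpha>\<^sup>2 / (\<kappa> ^ 6 * \<beta>\<^sup>2))"
  define D where "D t = factor_dist d r M (Fs t)" for t
  have "(D t)\<^sup>2 \<le> (1 - q) ^ t * (D 0)\<^sup>2 + 16 * \<epsilon>\<^sup>2"
  proof (cases "sing_val r Fstar = 0")
    case True
    \<comment> \<open>Division by zero makes \<open>\<kappa>\<close>, and with it the step size, vanish.\<close>
    then have \<kappa>0: "\<kappa> = 0" by (simp add: \<kappa>)
    have "Fs t = Fs 0 \<and> Fs t \<in> S" for t
    proof (induction t)
      case 0
      then show ?case using F0 by simp
    next
      case (Suc t)
      then have t: "Fs t \<in> S" by blast
      have cF: "Fs t \<in> carrier_mat d r" and cF': "Fs (Suc t) \<in> carrier_mat d r"
        using t nearest[OF t] S by (auto simp: nearest_points_def)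
      have "frob_norm (Fs (Suc t) - Fs t) \<le> \<eta> * frob_norm (gradient d r f (Fs t))"
        by (rule projected_step_length[OF S t grad[OF cF] nearest[OF t]]) (simp add: \<eta> \<kappa>0)
      then have "frob_norm (Fs (Suc t) - Fs t) = 0"
        using frob_norm_nonneg[OF minus_carrier_mat[OF cF], of "Fs (Suc t)"] by (simp add: \<eta> \<kappa>0)
      then have "Fs (Suc t) = Fs t" by (rule frob_norm_diff_eq_0D[OF cF' cF])
      then show ?case using Suc.IH by metis
    qed
    then have "D t = D 0" by (metis D_def)
    then show ?thesis by (simp add: q_def \<kappa>0)
  next
    case False
    define \<sigma> where "\<sigma> = sing_val r Fstar"
    have s: "0 < sing_val r Fstar" using False sing_val_last_nonneg[OF Fstar r] by simp
    have "\<sigma> \<le> sing_val 1 Fstar"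
      using sing_val_last_le[OF Fstar r r] sing_val_first_ge[OF Fstar r r] by (simp add: \<sigma>_def)
    then have "1 \<le> \<kappa>" unfolding \<kappa> \<sigma>_def[symmetric] using s by (simp add: \<sigma>_def)
    then have K: "1 \<le> \<kappa> ^ 6" by (rule one_le_power)
    have "\<alpha>\<^sup>2 \<le> \<beta>\<^sup>2" using ab by (intro power_mono) auto
    then have "1 * \<alpha>\<^sup>2 \<le> \<kappa> ^ 6 * \<beta>\<^sup>2" using K by (intro mult_mono) auto
    moreover have "0 < \<kappa> ^ 6 * \<beta>\<^sup>2"
      using K ab zero_less_power[of \<beta> 2] by (intro mult_pos_pos) linarith+
    ultimately have "\<alpha>\<^sup>2 / (\<kappa> ^ 6 * \<beta>\<^sup>2) \<le> 1" by (simp add: divide_le_eq_1)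
    then have "q \<le> c" unfolding q_def using c0 by (intro mult_left_le) (auto simp: c_def)
    then have q1: "q \<le> 1" using c1 by (simp add: c_def)
    have q0: "0 \<le> q" using c0 K by (simp add: q_def c_def)
    note q = q0 q1
    have rec: "(D (Suc t))\<^sup>2 \<le> (1 - q) * (D t)\<^sup>2 + 16 * q * \<epsilon>\<^sup>2"
      if "Fs t \<in> S" "D t \<le> (1 - \<tau>) * \<sigma>" for t
      unfolding D_def q_def c_def
      by (rule projected_gradient_contraction[OF assms r Fstar s \<kappa> grad S ab \<epsilon>(1) \<rho> conds(1,2) _ conds(4)
            \<eta> that(1) _ nearest[OF that(1)]]) (use that(2) conds(3) L in \<open>auto simp: D_def \<sigma>_def\<close>)
    \<comment> \<open>The induction carries feasibility and the smaller ball along with the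
      estimate, since the one-step bound requires both.\<close>
    have "Fs t \<in> S \<and> D t \<le> (1 - \<tau>) * \<sigma> \<and> (D t)\<^sup>2 \<le> (1 - q) ^ t * (D 0)\<^sup>2 + 16 * \<epsilon>\<^sup>2" for t
    proof (induction t)
      case 0
      then show ?case using F0 by (simp add: D_def \<sigma>_def factor_ball_def)
    next
      case (Suc t)
      then have t: "Fs t \<in> S" "D t \<le> (1 - \<tau>) * \<sigma>"
        and IH: "(D t)\<^sup>2 \<le> (1 - q) ^ t * (D 0)\<^sup>2 + 16 * \<epsilon>\<^sup>2" by auto
      have F: "Fs (Suc t) \<in> S" using nearest[OF t(1)] by (simp add: nearest_points_def)
      have "0 \<le> D t"
      proof -
        have "Fs t \<in> carrier_mat d r" using t(1) S by auto
        then have "\<And>A. A \<in> equiv_factors d r M \<Longrightarrow> 0 \<le> frob_norm (Fs t - A)"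
          using equiv_factorsD(1) frob_norm_nonneg[OF minus_carrier_mat] by blast
        then show ?thesis unfolding D_def factor_dist_def using Fstar by (intro cINF_greatest) auto
      qed
      then have Dt: "(D t)\<^sup>2 \<le> ((1 - \<tau>) * \<sigma>)\<^sup>2" using t(2) by (intro power_mono)
      \<comment> \<open>The bound on \<epsilon> says that \<open>16 * \<epsilon>\<^sup>2\<close> is
        at most the squared radius of the smaller ball. The new squared distance is thus bounded by
        a convex combination of two numbers below that squared radius, and the ball is
        preserved.\<close>
      have "(4 * \<epsilon>)\<^sup>2 \<le> ((1 - \<tau>) * \<sigma>)\<^sup>2" using \<epsilon> by (intro power_mono) (auto simp: \<sigma>_def)
      then have \<epsilon>2: "16 * \<epsilon>\<^sup>2 \<le> ((1 - \<tau>) * \<sigma>)\<^sup>2" by (simp add: power_mult_distrib)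
      have "(D (Suc t))\<^sup>2 \<le> (1 - q) * (D t)\<^sup>2 + q * (16 * \<epsilon>\<^sup>2)" using rec[OF t] by simp
      also have "\<dots> \<le> (1 - q) * ((1 - \<tau>) * \<sigma>)\<^sup>2 + q * ((1 - \<tau>) * \<sigma>)\<^sup>2"
        using Dt \<epsilon>2 q by (intro add_mono mult_left_mono) auto
      also have "\<dots> = ((1 - \<tau>) * \<sigma>)\<^sup>2" by (simp add: left_diff_distrib)
      finally have "D (Suc t) \<le> (1 - \<tau>) * \<sigma>"
        by (rule power2_le_imp_le) (use assms s in \<open>simp add: \<sigma>_def\<close>)
      \<comment> \<open>\<open>16 * \<epsilon>\<^sup>2\<close> is the fixed point of the recursion
        \<open>y \<mapsto> (1 - q) * y + 16 * q * \<epsilon>\<^sup>2\<close>, so the noise does not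
        accumulate.\<close>
      moreover have "(D (Suc t))\<^sup>2 \<le> (1 - q) ^ Suc t * (D 0)\<^sup>2 + 16 * \<epsilon>\<^sup>2"
        using rec[OF t] mult_left_mono[OF IH, of "1 - q"] q by (simp add: algebra_simps)
      ultimately show ?case using F by blast
    qed
    then show ?thesis by blast
  qed
  then show "(factor_dist d r M (Fs t))\<^sup>2 \<le> (1 - \<tau> ^ 4 * (1 - \<tau>) / 8 * (\<alpha>\<^sup>2 / (\<kappa> ^ 6 * \<beta>\<^sup>2))) ^ t
      * (factor_dist d r M (Fs 0))\<^sup>2 + 16 * \<epsilon>\<^sup>2"
    unfolding D_def q_def c_def .
qed

end
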